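(* For $\Delta>0$, let $\mu$ be the probability measure on $\mathbb{Z}$ given by $$\mu(x) = \int \mu_\omega(x)\, Z_\omega^{-1}\, \mathbf{P}(\mathrm{d}\omega) \qquad (x\in\mathbb{Z}),$$ (with $\mathbf{P}$, $\mu_\omega$ and $Z_\omega$, depending on $\Delta$, as defined in the context), which represents the long-term behavior of the linearly edge-reinforced random walk $(X_n)_{n\ge0}$ on $\mathbb{Z}$ with reinforcement parameter $\Delta$ started at $0$, in the sense that $$\lim_{m\to\infty}\frac{1}{m+1}\sum_{n=0}^m\mathbb{P}[X_n=x]=\mu(x)\qquad(x\in\mathbb{Z}).$$ Then $\mu$ is symmetric about zero, i.e. $\mu(-x)=\mu(x)$ for $x\in\mathbb{Z}$, and $\mu(x)\le C e^{-d|x|}$ for all $x\in\mathbb{Z}$, where $C,d>0$ are constants depending only on $\Delta$ (with $d\to0$ for $\Delta\to0$ and $d\to\infty$ for $\Delta\to\infty$). Let $X$ be an integer-valued random variable with law $\mu$. Then $\mathbb{E}[X]=0$ and all moments of $X$ exist and are finite ($\mathbb{E}[X^n]=0$ for $n\ge0$ odd, and $0<\mathbb{E}[X^n]<\infty$ for $n\ge0$ even).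
   Context: ERRW on $\mathbb{Z}$. $\mathbb{Z}$ is the nearest-neighbor graph with edges $\{x,x+1\}$ (a tree with root $0$). The linearly edge-reinforced random walk with parameter $\Delta>0$ starts at $X_0=0$; the edge weights are $w_0\equiv1$ and $w_n(\{u,v\})=1+\Delta\sum_{i=1}^n\mathbf{1}_{\{X_{i-1},X_i\}=\{u,v\}}$ for $n\ge1$. Given the history up to time $n$ with $X_n=u$, the walk moves to $v\in\{u-1,u+1\}$ with probability $w_n(\{u,v\})/(w_n(\{u,u-1\})+w_n(\{u,u+1\}))$. Environment. Under the probability measure $\mathbf{P}$, $\omega=(\omega_x)_{x\in\mathbb{Z}}$ is a family of independent random variables with $\omega_x\sim B\left(\frac{1}{2\Delta},\frac{1+\Delta}{2\Delta}\right)$ for $x>0$, $\omega_0\sim B\left(\frac1{2\Delta},\frac1{2\Delta}\right)$, and $\omega_x\sim B\left(\frac{1+\Delta}{2\Delta},\frac1{2\Delta}\right)$ for $x<0$. Here $B(\alpha,\beta)$ is the Beta distribution with density $\frac{\Gamma(\alpha+\beta)}{\Gamma(\alpha)\Gamma(\beta)}y^{\alpha-1}(1-y)^{\beta-1}$ on $[0,1]$. (Here $\omega_x$ is the probability to go from $x$ to $x+1$ in the environment $\omega$, and $1-\omega_x$ the probability to go from $x$ to $x-1$.) Stationary measure of the chain in environment $\omega$: $\mu_\omega(0)=1$, $$\mu_\omega(x)=\frac{\omega_0}{1-\omega_x}\prod_{i=1}^{x-1}\frac{\omega_i}{1-\omega_i}\ \ (x>0),\qquad \mu_\omega(x)=\frac{1-\omega_0}{\omega_x}\prod_{i=x+1}^{-1}\frac{1-\omega_i}{\omega_i}\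 \ (x<0),$$ and $Z_\omega=\sum_{x\in\mathbb{Z}}\mu_\omega(x)$, which is finite $\mathbf{P}$-almost surely. *)

theory Defs
  imports "HOL-Probability.Probability"
begin

definition beta_measure :: "real \<Rightarrow> real \<Rightarrow> real measure" where
  "beta_measure \<alpha> \<beta> = density lborel
     (\<lambda>y. ennreal (indicator {0..1} y *
        (Gamma (\<alpha> + \<beta>) / (Gamma \<alpha> * Gamma \<beta>) * y powr (\<alpha> - 1) * (1 - y) powr (\<beta> - 1))))"

text \<open>The environment assigns to each site \<open>x\<close> the probability \<open>\<omega> x\<close> of stepping from \<open>x\<close> to \<open>x + 1\<close>.\<close>

definition site_law :: "real \<Rightarrow> int \<Rightarrow> real measure" where
  "site_law \<Delta> x =
     (if x > 0 then beta_measure (1 / (2 * \<Delta>)) ((1 + \<Delta>) / (2 * \<Delta>))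
      else if x = 0 then beta_measure (1 / (2 * \<Delta>)) (1 / (2 * \<Delta>))
      else beta_measure ((1 + \<Delta>) / (2 * \<Delta>)) (1 / (2 * \<Delta>)))"

definition env_law :: "real \<Rightarrow> (int \<Rightarrow> real) measure" where
  "env_law \<Delta> = PiM UNIV (site_law \<Delta>)"

text \<open>Some \<open>\<omega> x\<close> lies outside the open unit interval only on a null set, so the convention
  \<open>a / 0 = 0\<close> plays no role here.\<close>

definition stat_env :: "(int \<Rightarrow> real) \<Rightarrow> int \<Rightarrow> real" where
  "stat_env \<omega> x =
     (if x = 0 then 1
      else if x > 0 then \<omega> 0 / (1 - \<omega> x) * (\<Prod>i\<in>{1..x - 1}. \<omega> i / (1 - \<omega> i))
      else (1 - \<omega> 0) / \<omega> x * (\<Prod>i\<in>{x + 1..-1}. (1 - \<omega> i) / \<omega> i))"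

text \<open>\<open>infsum\<close> is \<open>0\<close> for a divergent series; the inverse is then \<open>0\<close>, in accordance
  with \<open>1 / \<infinity> = 0\<close>. This happens only on a null set.\<close>

definition stat_norm :: "(int \<Rightarrow> real) \<Rightarrow> real" where
  "stat_norm \<omega> = (\<Sum>\<^sub>\<infinity>x. stat_env \<omega> x)"

definition limit_mass :: "real \<Rightarrow> int \<Rightarrow> real" where
  "limit_mass \<Delta> x = (\<integral>\<omega>. stat_env \<omega> x * inverse (stat_norm \<omega>) \<partial>env_law \<Delta>)"

definition limit_law :: "real \<Rightarrow> int measure" where
  "limit_law \<Delta> = density (count_space UNIV) (\<lambda>x. ennreal (limit_mass \<Delta> x))"

text \<open>The weight of the edge \<open>e = {u, v}\<close> at time \<open>n\<close> along the trajectory \<open>x\<close>.\<close>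

definition edge_weight :: "real \<Rightarrow> (nat \<Rightarrow> int) \<Rightarrow> nat \<Rightarrow> int set \<Rightarrow> real" where
  "edge_weight \<Delta> x n e = 1 + \<Delta> * (\<Sum>i\<in>{1..n}. of_bool ({x (i - 1), x i} = e))"

text \<open>\<open>X\<close> is a linearly edge-reinforced random walk on the probability space \<open>M\<close>. The
  history up to time \<open>n\<close> takes only countably many values, so conditioning on it amounts to
  conditioning on the events \<open>X\<^sub>0 = x 0, \<dots>, X\<^sub>n = x n\<close> of positive probability.\<close>

definition is_errw :: "real \<Rightarrow> 'a measure \<Rightarrow> (nat \<Rightarrow> 'a \<Rightarrow> int) \<Rightarrow> bool" where
  "is_errw \<Delta> M X \<longleftrightarrow>
     prob_space M \<and>
     (\<forall>n. X n \<in> measurable M (count_space UNIV)) \<and>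
     (AE a in M. X 0 a = 0) \<and>
     (\<forall>n x. \<forall>v\<in>{x n - 1, x n + 1}.
        \<P>(a in M. \<forall>i\<le>n. X i a = x i) > 0 \<longrightarrow>
        \<P>(a in M. X (Suc n) a = v \<bar> \<forall>i\<le>n. X i a = x i) =
          edge_weight \<Delta> x n {x n, v} /
            (edge_weight \<Delta> x n {x n, x n - 1} + edge_weight \<Delta> x n {x n, x n + 1}))"

end

theory Submission
  imports Defs "HOL-Real_Asymp.Real_Asymp"
begin

text \<open>Since the graph is a tree, the weights seen by the reinforced walk at a site depend only on the
  numbers of earlier up and down steps from that site, in the way of a Polya urn. By the recursion of
  the Beta function the path probabilities are therefore those of a walk in an independent Beta
  environment.

  For a fixed environment \<open>\<omega>\<close> with summable reversible measure \<open>\<mu>\<close>, \<open>\<mu> 0 = 1\<close>, the law at time \<open>n\<close> of the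
  walk from 0 is dominated by \<open>\<mu>\<close>. The time-averaged flow through each edge is at most \<open>1 / (m + 1)\<close> in
  absolute value, so the averaged law becomes proportional to \<open>\<mu>\<close>, and dominated convergence for the
  total mass identifies the constant as \<open>1 / Z\<close>. This needs neither aperiodicity nor an
  ergodic theorem, and integrating over the environment is again dominated convergence.

  Finally \<open>\<mu> x / Z \<le> min 1 (\<mu> x) \<le> \<mu> x powr (1 / 4)\<close>, whose expectation is a product of moments of
  independent variables and hence decays geometrically. If \<open>S\<close> is the sum of \<open>\<mu> x powr (1 / 4)\<close>, then
  \<open>\<mu> x \<le> S ^ 3 * \<mu> x powr (1 / 4)\<close>, which gives the almost sure summability of \<open>\<mu>\<close>.\<close>

section \<open>Beta measures\<close>

lemma sets_beta_measure [measurable_cong, simp]: "sets (beta_measure a b) = sets borel"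
  by (simp add: beta_measure_def)

lemma space_beta_measure [simp]: "space (beta_measure a b) = UNIV"
  by (simp add: beta_measure_def)

lemma Beta_pos: "a > 0 \<Longrightarrow> b > 0 \<Longrightarrow> Beta a b > (0::real)"
  by (simp add: Beta_def)

lemma nn_integral_beta_measure_powr:
  fixes a b s t :: real
  assumes "a > 0" "b > 0" "a + s > 0" "b + t > 0"
  shows "(\<integral>\<^sup>+ y. ennreal (y powr s * (1 - y) powr t) \<partial>beta_measure a b) =
    ennreal (Beta (a + s) (b + t) / Beta a b)"
proof -
  let ?f = "\<lambda>y::real. y powr ((a + s) - 1) * (1 - y) powr ((b + t) - 1)"
  have c: "Gamma (a + b) / (Gamma a * Gamma b) = 1 / Beta a b"
    by (simp add: Beta_def)
  have "(\<integral>\<^sup>+ y. ennreal (y powr s * (1 - y) powr t) \<partial>beta_measure a b) =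
    (\<integral>\<^sup>+ y. ennreal (indicator {0..1} y *
        (Gamma (a + b) / (Gamma a * Gamma b) * y powr (a - 1) * (1 - y) powr (b - 1))) *
        ennreal (y powr s * (1 - y) powr t) \<partial>lborel)"
    unfolding beta_measure_def by (subst nn_integral_density) auto
  also have "\<dots> = (\<integral>\<^sup>+ y. ennreal (1 / Beta a b) * ennreal (indicator {0..1} y * ?f y) \<partial>lborel)"
    unfolding c
  proof (intro nn_integral_cong)
    fix y :: real
    have "y powr ((a + s) - 1) = y powr (a - 1) * y powr s"
         "(1 - y) powr ((b + t) - 1) = (1 - y) powr (b - 1) * (1 - y) powr t"
      by (simp_all flip: powr_add add: algebra_simps)
    then show "ennreal (indicator {0..1} y * (1 / Beta a b * y powr (a - 1) * (1 - y) powr (b - 1))) *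
      ennreal (y powr s * (1 - y) powr t) = ennreal (1 / Beta a b) * ennreal (indicator {0..1} y * ?f y)"
      using Beta_pos[OF assms(1,2)]
      by (auto simp: indicator_def ac_simps simp flip: ennreal_mult)
  qed
  also have "\<dots> = ennreal (1 / Beta a b) * (\<integral>\<^sup>+ y. ennreal (indicator {0..1} y * ?f y) \<partial>lborel)"
    by (rule nn_integral_cmult) auto
  also have "(\<integral>\<^sup>+ y. ennreal (indicator {0..1} y * ?f y) \<partial>lborel) = ennreal (Beta (a + s) (b + t))"
    by (rule nn_integral_has_integral_lebesgue) (use assms has_integral_Beta_real in auto)
  finally show ?thesis
    using Beta_pos[OF assms(1,2)] Beta_pos[OF assms(3,4)] by (simp flip: ennreal_mult)
qed

lemma AE_beta_measure: "AE y in beta_measure a b. 0 < y \<and> y < 1"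
  unfolding beta_measure_def
proof (subst AE_density)
  show "AE y in lborel. 0 < ennreal (indicator {0..1} y *
          (Gamma (a + b) / (Gamma a * Gamma b) * y powr (a - 1) * (1 - y) powr (b - 1))) \<longrightarrow>
         0 < y \<and> y < (1::real)"
    using AE_lborel_singleton[of 0] AE_lborel_singleton[of 1]
    by eventually_elim (auto simp: indicator_def)
qed simp

lemma nn_integral_beta_measure_power:
  fixes a b :: real
  assumes "a > 0" "b > 0"
  shows "(\<integral>\<^sup>+ y. ennreal (y ^ m * (1 - y) ^ n) \<partial>beta_measure a b) =
    ennreal (Beta (a + m) (b + n) / Beta a b)"
proof -
  have "(\<integral>\<^sup>+ y. ennreal (y ^ m * (1 - y) ^ n) \<partial>beta_measure a b) =
    (\<integral>\<^sup>+ y. ennreal (y powr m * (1 - y) powr n) \<partial>beta_measure a b)"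
    \<comment> \<open>\<open>0 powr 0\<close> is 0 whereas \<open>0 ^ 0\<close> is 1, so the
      integrands may differ at the end points, which form a null set.\<close>
    by (rule nn_integral_cong_AE, use AE_beta_measure[of a b] in eventually_elim)
       (simp add: powr_realpow)
  then show ?thesis
    using nn_integral_beta_measure_powr[of a b m n] assms by (simp add: add_pos_nonneg)
qed

lemma prob_space_beta_measure:
  assumes "a > 0" "b > 0"
  shows "prob_space (beta_measure a b)"
proof (rule prob_spaceI)
  show "emeasure (beta_measure a b) (space (beta_measure a b)) = 1"
    using nn_integral_beta_measure_power[OF assms, of 0 0] Beta_pos[OF assms] by simp
qed

text \<open>The substitution of \<open>1 - y\<close> for \<open>y\<close> preserves Lebesgue measure
  and exchanges the two factors of the density.\<close>

lemma distr_beta_measure_flip: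
  "distr (beta_measure a b) borel (\<lambda>y. 1 - y) = beta_measure b a"
proof (rule measure_eqI)
  fix A assume "A \<in> sets (distr (beta_measure a b) borel (\<lambda>y. 1 - y))"
  then have [measurable]: "A \<in> sets borel" by simp
  define f where "f a b y = ennreal (indicator {0..1} y *
    (Gamma (a + b) / (Gamma a * Gamma b) * y powr (a - 1) * (1 - y) powr (b - 1)))" for a b y :: real
  have [measurable]: "f a b \<in> borel_measurable borel" for a b
    unfolding f_def by measurable
  have flip: "f a b (1 - y) = f b a y" for y
    unfolding f_def by (auto simp: indicator_def ac_simps)
  have m: "emeasure (beta_measure a b) B = (\<integral>\<^sup>+ y. f a b y * indicator B y \<partial>lborel)"
    if "B \<in> sets borel" for a b B
    unfolding beta_measure_def f_def using that by (subst emeasure_density) auto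
  have "emeasure (distr (beta_measure a b) borel (\<lambda>y. 1 - y)) A =
      emeasure (beta_measure a b) ((\<lambda>y. 1 - y) -` A)"
    by (subst emeasure_distr) auto
  also have "\<dots> = (\<integral>\<^sup>+ y. f a b y * indicator ((\<lambda>y. 1 - y) -` A) y \<partial>lborel)"
  proof (rule m)
    have "(\<lambda>y::real. 1 - y) -` A \<inter> space borel \<in> sets borel"
      by (rule measurable_sets[where A = borel]) auto
    then show "(\<lambda>y::real. 1 - y) -` A \<in> sets borel" by simp
  qed
  also have "\<dots> = (\<integral>\<^sup>+ y. f a b (1 - y) * indicator A y \<partial>lborel)"
    by (subst nn_integral_real_affine[where c = "-1" and t = 1])
       (auto simp: indicator_def intro!: nn_integral_cong)
  also have "\<dots> = emeasure (beta_measure b a) A"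
    by (simp add: flip m)
  finally show "emeasure (distr (beta_measure a b) borel (\<lambda>y. 1 - y)) A = emeasure (beta_measure b a) A" .
qed simp

section \<open>The random environment\<close>

text \<open>\<open>site_a\<close> and \<open>site_b\<close> are the weights of the upper and lower
  edge at \<open>x\<close> on the first visit to \<open>x\<close>, divided by
  \<open>2 * \<Delta>\<close>: for \<open>x\<close> other than 0, the edge towards 0 has then been
  crossed once. An excursion from \<open>x\<close> through an edge and back adds
  \<open>2 * \<Delta>\<close>, which is one unit on this scale.\<close>

definition site_a :: "real \<Rightarrow> int \<Rightarrow> real" where
  "site_a \<Delta> x = (if x < 0 then (1 + \<Delta>) / (2 * \<Delta>) else 1 / (2 * \<Delta>))"

definition site_b :: "real \<Rightarrow> int \<Rightarrow> real" where
  "site_b \<Delta> x = (if x > 0 then (1 + \<Delta>) / (2 * \<Delta>) else 1 / (2 * \<Delta>))"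

lemma site_law_eq: "site_law \<Delta> x = beta_measure (site_a \<Delta> x) (site_b \<Delta> x)"
  by (auto simp: site_law_def site_a_def site_b_def)

lemma site_a_pos: "\<Delta> > 0 \<Longrightarrow> site_a \<Delta> x > 0"
  and site_b_pos: "\<Delta> > 0 \<Longrightarrow> site_b \<Delta> x > 0"
  by (auto simp: site_a_def site_b_def intro!: divide_pos_pos)

lemma sets_site_law [measurable_cong, simp]: "sets (site_law \<Delta> x) = sets borel"
  by (simp add: site_law_eq)

lemma space_site_law [simp]: "space (site_law \<Delta> x) = UNIV"
  by (simp add: site_law_eq)

lemma prob_space_site_law: "\<Delta> > 0 \<Longrightarrow> prob_space (site_law \<Delta> x)"
  by (simp add: site_law_eq site_a_pos site_b_pos prob_space_beta_measure)

lemma space_env_law [simp]: "space (env_law \<Delta>) = UNIV"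
  by (simp add: env_law_def space_PiM)

lemma measurable_env_law_component [measurable]: "(\<lambda>\<omega>. \<omega> x) \<in> borel_measurable (env_law \<Delta>)"
  unfolding env_law_def
  by (rule measurable_compose[OF measurable_component_singleton[where i = x]]) auto

lemma prob_space_env_law: "\<Delta> > 0 \<Longrightarrow> prob_space (env_law \<Delta>)"
  unfolding env_law_def by (intro prob_space_PiM prob_space_site_law)

lemma AE_site_law: "AE y in site_law \<Delta> x. 0 < y \<and> y < 1"
  unfolding site_law_eq by (rule AE_beta_measure)

lemma AE_env_law: "\<Delta> > 0 \<Longrightarrow> AE \<omega> in env_law \<Delta>. \<forall>x. 0 < \<omega> x \<and> \<omega> x < 1"
  unfolding AE_all_countable env_law_def
  by (intro allI AE_PiM_component prob_space_site_law) (auto intro: prob_space_site_law AE_site_law simp del: AE_conj_iff)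

text \<open>The integrand depends only on the coordinates in \<open>J\<close>, so the infinite
  product may be replaced by its finite marginal, where the integral factorises.\<close>

lemma nn_integral_env_law_prod:
  assumes "\<Delta> > 0" "finite J" and "\<And>x. x \<in> J \<Longrightarrow> f x \<in> borel_measurable borel"
  shows "(\<integral>\<^sup>+ \<omega>. (\<Prod>x\<in>J. f x (\<omega> x)) \<partial>env_law \<Delta>) = (\<Prod>x\<in>J. \<integral>\<^sup>+ y. f x y \<partial>site_law \<Delta> x)"
proof -
  interpret prob_space "site_law \<Delta> x" for x
    using assms by (intro prob_space_site_law)
  interpret product_prob_space "site_law \<Delta>" UNIV ..
  have f: "f x \<in> borel_measurable (site_law \<Delta> x)" if "x \<in> J" for x
    by (subst measurable_cong_sets[OF sets_site_law refl]) (rule assms(3)[OF that])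
  have [measurable]: "(\<lambda>\<omega>. \<Prod>x\<in>J. f x (\<omega> x)) \<in> borel_measurable (PiM J (site_law \<Delta>))"
    by (intro borel_measurable_prod_ennreal measurable_compose[OF measurable_component_singleton])
       (assumption | rule f)+
  have "(\<Prod>x\<in>J. \<integral>\<^sup>+ y. f x y \<partial>site_law \<Delta> x) = (\<integral>\<^sup>+ \<omega>. (\<Prod>x\<in>J. f x (\<omega> x)) \<partial>PiM J (site_law \<Delta>))"
    using assms f by (intro product_nn_integral_prod[symmetric]) simp_all
  also have "\<dots> = (\<integral>\<^sup>+ \<omega>. (\<Prod>x\<in>J. f x (restrict \<omega> J x)) \<partial>env_law \<Delta>)"
    unfolding env_law_def
    by (subst distr_PiM_restrict_finite[OF assms(2) subset_UNIV, symmetric], rule nn_integral_distr)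
       (auto intro!: measurable_restrict_subset)
  finally show ?thesis by simp
qed

text \<open>The environment of the mirrored walk: its up step from \<open>x\<close> is the down step
  of the original walk from \<open>- x\<close>.\<close>

definition env_flip :: "(int \<Rightarrow> real) \<Rightarrow> int \<Rightarrow> real" where
  "env_flip \<omega> x = 1 - \<omega> (- x)"

lemma distr_site_law_flip:
  "distr (site_law \<Delta> x) borel (\<lambda>y. 1 - y) = site_law \<Delta> (- x)"
  unfolding site_law_eq by (simp add: distr_beta_measure_flip) (auto simp: site_a_def site_b_def)

lemma measurable_env_flip [measurable]: "env_flip \<in> measurable (env_law \<Delta>) (env_law \<Delta>)"
proof -
  have "(\<lambda>\<omega> x. 1 - \<omega> (- x)) \<in> measurable (env_law \<Delta>) (PiM UNIV (site_law \<Delta>))"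
    by (rule measurable_PiM_single') (auto simp: PiE_iff)
  then show ?thesis by (simp add: env_flip_def[abs_def] env_law_def)
qed

text \<open>A product measure is determined by its values on cylinders. The preimage of a cylinder
  is a cylinder over the mirrored index set, and flipping the law of site \<open>- j\<close> gives
  the law of site \<open>j\<close>.\<close>

lemma distr_env_flip:
  assumes "\<Delta> > 0"
  shows "distr (env_law \<Delta>) (env_law \<Delta>) env_flip = env_law \<Delta>"
proof -
  interpret prob_space "site_law \<Delta> x" for x
    using assms by (intro prob_space_site_law)
  interpret product_prob_space "site_law \<Delta>" UNIV ..
  have "distr (env_law \<Delta>) (env_law \<Delta>) env_flip = PiM UNIV (site_law \<Delta>)"
  proof (rule PiM_eq)
    fix J and F :: "int \<Rightarrow> real set"
    assume J: "finite J" "J \<subseteq> UNIV" and F: "\<And>j. j \<in> J \<Longrightarrow> F j \<in> sets (site_law \<Delta> j)"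
    let ?G = "\<lambda>j. (\<lambda>y. 1 - y) -` F (- j)"
    have G: "?G j \<in> sets borel" if "j \<in> uminus ` J" for j
    proof -
      have "?G j \<inter> space borel \<in> sets borel"
        by (rule measurable_sets[where A = borel]) (use that F in auto)
      then show ?thesis by simp
    qed
    have "emeasure (distr (env_law \<Delta>) (env_law \<Delta>) env_flip) (prod_emb UNIV (site_law \<Delta>) J (Pi\<^sub>E J F)) =
      emeasure (env_law \<Delta>) (env_flip -` prod_emb UNIV (site_law \<Delta>) J (Pi\<^sub>E J F))"
      using J F by (subst emeasure_distr[OF measurable_env_flip]) (auto simp: env_law_def space_PiM intro!: sets_PiM_I)
    also have "env_flip -` prod_emb UNIV (site_law \<Delta>) J (Pi\<^sub>E J F) =
      prod_emb UNIV (site_law \<Delta>) (uminus ` J) (Pi\<^sub>E (uminus ` J) ?G)"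
      by (auto simp: prod_emb_def PiE_iff env_flip_def space_PiM)
    also have "emeasure (env_law \<Delta>) \<dots> = (\<Prod>j\<in>uminus ` J. emeasure (site_law \<Delta> j) (?G j))"
      unfolding env_law_def using J G by (intro emeasure_PiM_emb) auto
    also have "\<dots> = (\<Prod>j\<in>J. emeasure (site_law \<Delta> (- j)) ((\<lambda>y. 1 - y) -` F j))"
      by (subst prod.reindex) (auto simp: inj_on_def)
    also have "\<dots> = (\<Prod>j\<in>J. emeasure (site_law \<Delta> j) (F j))"
    proof (intro prod.cong refl)
      fix j assume "j \<in> J"
      moreover have "(\<lambda>y::real. 1 - y) \<in> borel_measurable (site_law \<Delta> (- j))"
        by (subst measurable_cong_sets[OF sets_site_law refl])
           (intro borel_measurable_diff borel_measurable_const measurable_ident_sets refl)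
      ultimately show "emeasure (site_law \<Delta> (- j)) ((\<lambda>y. 1 - y) -` F j) = emeasure (site_law \<Delta> j) (F j)"
        using F[of j] emeasure_distr[of "\<lambda>y. 1 - y" "site_law \<Delta> (- j)" borel "F j"]
        by (simp add: distr_site_law_flip)
    qed
    finally show "emeasure (distr (env_law \<Delta>) (env_law \<Delta>) env_flip)
        (prod_emb UNIV (site_law \<Delta>) J (Pi\<^sub>E J F)) = (\<Prod>j\<in>J. emeasure (site_law \<Delta> j) (F j))" .
  qed (simp add: env_law_def)
  then show ?thesis by (simp add: env_law_def)
qed

section \<open>The walk in a fixed environment\<close>

text \<open>The recursion decomposes at the first step. In this form the walk is later continued
  from the end of a prescribed initial path.\<close>

primrec walk_prob :: "(int \<Rightarrow> real) \<Rightarrow> nat \<Rightarrow> int \<Rightarrow> int \<Rightarrow> real" where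
  "walk_prob \<omega> 0 u v = of_bool (u = v)"
| "walk_prob \<omega> (Suc k) u v = \<omega> u * walk_prob \<omega> k (u + 1) v + (1 - \<omega> u) * walk_prob \<omega> k (u - 1) v"

text \<open>The distribution function of the walk is introduced by recursion on the starting point;
  that it changes in one step by the net flow through the edge \<open>{x, x + 1}\<close> is then an induction
  without infinite sums.\<close>

primrec walk_cdf :: "(int \<Rightarrow> real) \<Rightarrow> nat \<Rightarrow> int \<Rightarrow> int \<Rightarrow> real" where
  "walk_cdf \<omega> 0 u x = of_bool (u \<le> x)"
| "walk_cdf \<omega> (Suc k) u x = \<omega> u * walk_cdf \<omega> k (u + 1) x + (1 - \<omega> u) * walk_cdf \<omega> k (u - 1) x"

text \<open>The forward equation follows from the backward one: the first step acts on
  \<open>u\<close>, the last step on \<open>v\<close>, and these two linear operations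
  commute.\<close>

lemma walk_prob_Suc_forward:
  "walk_prob \<omega> (Suc k) u v = walk_prob \<omega> k u (v - 1) * \<omega> (v - 1) + walk_prob \<omega> k u (v + 1) * (1 - \<omega> (v + 1))"
proof (induction k arbitrary: u)
  case 0
  show ?case by auto
next
  case (Suc k)
  show ?case
    by (subst walk_prob.simps(2), subst (1 2) Suc.IH) (simp add: algebra_simps)
qed

lemma walk_cdf_Suc:
  "walk_cdf \<omega> (Suc k) u x =
     walk_cdf \<omega> k u x - walk_prob \<omega> k u x * \<omega> x + walk_prob \<omega> k u (x + 1) * (1 - \<omega> (x + 1))"
proof (induction k arbitrary: u)
  case 0
  consider "u < x" | "u = x" | "u = x + 1" | "u > x + 1" by linarith
  then show ?case by cases auto
next
  case (Suc k)
  show ?case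
    by (subst walk_cdf.simps(2), subst (1 2) Suc.IH) (simp add: algebra_simps)
qed

lemma has_sum_walk_prob: "(walk_prob \<omega> k u has_sum 1) UNIV"
proof (induction k arbitrary: u)
  case 0
  have "((\<lambda>v. of_bool (u = v)) has_sum (\<Sum>v\<in>{u}. of_bool (u = v))) {u}"
    by (rule has_sum_finite) simp
  then have "((\<lambda>v. of_bool (u = v) :: real) has_sum 1) {u}"
    by simp
  then show ?case
    by (rule has_sum_cong_neutral[THEN iffD1, rotated -1]) auto
next
  case (Suc k)
  have "((\<lambda>v. \<omega> u * walk_prob \<omega> k (u + 1) v + (1 - \<omega> u) * walk_prob \<omega> k (u - 1) v)
    has_sum (\<omega> u * 1 + (1 - \<omega> u) * 1)) UNIV"
    by (intro has_sum_add has_sum_cmult_right Suc.IH)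
  then show ?case by simp
qed

text \<open>The almost sure event on which every denominator in \<open>stat_env\<close> is positive;
  the arguments for a fixed environment are carried out on it.\<close>

definition elliptic :: "(int \<Rightarrow> real) \<Rightarrow> bool" where
  "elliptic \<omega> \<longleftrightarrow> (\<forall>x. 0 < \<omega> x \<and> \<omega> x < 1)"

lemma ellipticD: "elliptic \<omega> \<Longrightarrow> 0 < \<omega> x" "elliptic \<omega> \<Longrightarrow> \<omega> x < 1"
  by (auto simp: elliptic_def)

lemma walk_prob_nonneg: "elliptic \<omega> \<Longrightarrow> 0 \<le> walk_prob \<omega> k u v"
  by (induction k arbitrary: u) (auto simp: less_imp_le ellipticD)

lemma walk_prob_le_1: "elliptic \<omega> \<Longrightarrow> walk_prob \<omega> k u v \<le> 1"
proof (induction k arbitrary: u)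
  case (Suc k)
  then have "\<omega> u * walk_prob \<omega> k (u + 1) v + (1 - \<omega> u) * walk_prob \<omega> k (u - 1) v \<le> 1"
    by (intro convex_bound_le) (auto simp: less_imp_le ellipticD)
  then show ?case by simp
qed auto

lemma walk_cdf_bounds: "elliptic \<omega> \<Longrightarrow> 0 \<le> walk_cdf \<omega> k u x \<and> walk_cdf \<omega> k u x \<le> 1"
proof (induction k arbitrary: u)
  case (Suc k)
  then have "\<omega> u * walk_cdf \<omega> k (u + 1) x + (1 - \<omega> u) * walk_cdf \<omega> k (u - 1) x \<le> 1"
    by (intro convex_bound_le) (auto simp: less_imp_le ellipticD)
  with Suc show ?case by (auto simp: less_imp_le ellipticD)
qed auto

lemma stat_env_0 [simp]: "stat_env \<omega> 0 = 1"
  by (simp add: stat_env_def)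

lemma stat_env_pos:
  assumes "elliptic \<omega>"
  shows "0 < stat_env \<omega> x"
  unfolding stat_env_def using ellipticD[OF assms] by (auto intro!: prod_pos mult_pos_pos divide_pos_pos)

text \<open>Detailed balance across one edge. The cases separate the branches of
  \<open>stat_env\<close> at the root; away from it the products for neighbouring sites differ by a
  single factor.\<close>

lemma stat_env_balance:
  assumes "elliptic \<omega>"
  shows "stat_env \<omega> x * \<omega> x = stat_env \<omega> (x + 1) * (1 - \<omega> (x + 1))"
proof -
  have nz: "\<omega> y \<noteq> 0" "1 - \<omega> y \<noteq> 0" for y
    using ellipticD[OF assms, of y] by auto
  consider "x > 0" | "x = 0" | "x = -1" | "x < -1" by linarith
  then show ?thesis
  proof cases
    case 1
    then have "{1..x} = insert x {1..x - 1}" by auto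
    then have P: "(\<Prod>i\<in>{1..x}. \<omega> i / (1 - \<omega> i)) = \<omega> x / (1 - \<omega> x) * (\<Prod>i\<in>{1..x - 1}. \<omega> i / (1 - \<omega> i))"
      by simp
    show ?thesis using 1 nz by (simp add: stat_env_def P)
  next
    case 4
    then have "{x + 1..-1} = insert (x + 1) {x + 2..-1}" by auto
    then have P: "(\<Prod>i\<in>{x + 1..-1}. (1 - \<omega> i) / \<omega> i) =
        (1 - \<omega> (x + 1)) / \<omega> (x + 1) * (\<Prod>i\<in>{x + 2..-1}. (1 - \<omega> i) / \<omega> i)"
      by simp
    show ?thesis using 4 nz by (simp add: stat_env_def P add.assoc)
  qed (use nz in \<open>auto simp: stat_env_def field_simps\<close>)
qed

lemma stat_env_stationary:
  assumes "elliptic \<omega>"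
  shows "stat_env \<omega> (x - 1) * \<omega> (x - 1) + stat_env \<omega> (x + 1) * (1 - \<omega> (x + 1)) = stat_env \<omega> x"
  using stat_env_balance[OF assms, of x] stat_env_balance[OF assms, of "x - 1"]
  by (simp add: algebra_simps)

text \<open>The domination holds at time 0 because \<open>stat_env\<close> is 1 at the starting
  point. A step of the walk is monotone and leaves \<open>stat_env\<close> invariant, so it
  preserves the domination.\<close>

lemma walk_prob_le_stat_env:
  assumes "elliptic \<omega>"
  shows "walk_prob \<omega> k 0 v \<le> stat_env \<omega> v"
proof (induction k arbitrary: v)
  case 0
  show ?case using stat_env_pos[OF assms, of v] by (auto simp: less_imp_le)
next
  case (Suc k)
  have "walk_prob \<omega> (Suc k) 0 v \<le>
    stat_env \<omega> (v - 1) * \<omega> (v - 1) + stat_env \<omega> (v + 1) * (1 - \<omega> (v + 1))"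
    unfolding walk_prob_Suc_forward
    by (intro add_mono mult_right_mono Suc.IH) (auto simp: less_imp_le ellipticD assms)
  then show ?case by (simp add: stat_env_stationary assms)
qed

section \<open>Series as integrals for the counting measure\<close>

lemma summable_on_iff_integrable_count_space:
  fixes f :: "'a \<Rightarrow> real"
  shows "f summable_on UNIV \<longleftrightarrow> integrable (count_space UNIV) f"
  unfolding abs_summable_on_def[symmetric] abs_summable_equivalent[symmetric]
  by (rule summable_on_iff_abs_summable_on_real)

text \<open>For real terms both notions mean absolute convergence, and both values default to 0
  otherwise.\<close>

lemma infsum_eq_integral_count_space:
  fixes f :: "'a \<Rightarrow> real"
  shows "(\<Sum>\<^sub>\<infinity>x. f x) = (\<integral>x. f x \<partial>count_space UNIV)"
proof (cases "integrable (count_space UNIV) f")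
  case True
  then show ?thesis
    by (simp add: infsetsum_infsum[symmetric] abs_summable_on_def infsetsum_def)
next
  case False
  then show ?thesis
    by (simp add: infsum_not_exists summable_on_iff_integrable_count_space not_integrable_integral_eq)
qed

lemma tendsto_infsum_dominated:
  fixes f :: "nat \<Rightarrow> 'a::countable \<Rightarrow> real"
  assumes "\<And>x. (\<lambda>m. f m x) \<longlonglongrightarrow> g x" "h summable_on UNIV" "\<And>m x. \<bar>f m x\<bar> \<le> h x"
  shows "(\<lambda>m. \<Sum>\<^sub>\<infinity>x. f m x) \<longlonglongrightarrow> (\<Sum>\<^sub>\<infinity>x. g x)"
  unfolding infsum_eq_integral_count_space
proof (rule integral_dominated_convergence)
  show "integrable (count_space UNIV) h"
    using assms(2) by (simp add: summable_on_iff_integrable_count_space)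
qed (simp_all add: AE_count_space assms(1,3))

lemma ergodic_average_walk_prob:
  assumes el: "elliptic \<omega>" and sum: "stat_env \<omega> summable_on UNIV"
  shows "(\<lambda>m. (1 / (real m + 1)) * (\<Sum>n=0..m. walk_prob \<omega> n 0 x)) \<longlonglongrightarrow> stat_env \<omega> x * inverse (stat_norm \<omega>)"
proof -
  define A where "A m x = (1 / (real m + 1)) * (\<Sum>n=0..m. walk_prob \<omega> n 0 x)" for m x
  \<comment> \<open>\<open>D\<close> measures how far the averaged law \<open>A\<close> is from the
    multiple of \<open>stat_env\<close> that agrees with it at 0.\<close>
  define D where "D m x = A m x - stat_env \<omega> x * A m 0" for m x
  have A_nonneg: "0 \<le> A m x" for m x
    unfolding A_def by (intro mult_nonneg_nonneg sum_nonneg walk_prob_nonneg el) auto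
  have A_le: "A m x \<le> stat_env \<omega> x" for m x
  proof -
    have "(\<Sum>n=0..m. walk_prob \<omega> n 0 x) \<le> (real m + 1) * stat_env \<omega> x"
      using sum_mono[of "{0..m}" "\<lambda>n. walk_prob \<omega> n 0 x" "\<lambda>_. stat_env \<omega> x"] walk_prob_le_stat_env[OF el]
      by (simp add: algebra_simps)
    then show ?thesis by (simp add: A_def field_simps)
  qed
  have flux: "(\<lambda>m. A m x * \<omega> x - A m (x + 1) * (1 - \<omega> (x + 1))) \<longlonglongrightarrow> 0" for x
  proof (rule Lim_null_comparison)
    \<comment> \<open>Each summand is the net upward flow through \<open>{x, x + 1}\<close> at time
      \<open>n\<close>, which is the decrease of the distribution function at \<open>x\<close>;
      hence the sum telescopes.\<close>
    have "(\<Sum>n=0..m. walk_prob \<omega> n 0 x * \<omega> x - walk_prob \<omega> n 0 (x + 1) * (1 - \<omega> (x + 1))) =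
        walk_cdf \<omega> 0 0 x - walk_cdf \<omega> (Suc m) 0 x" for m
      by (induction m) (simp_all only: sum.atLeast0_atMost_Suc walk_cdf_Suc, simp_all)
    then have S: "(\<Sum>n=0..m. walk_prob \<omega> n 0 x) * \<omega> x - (\<Sum>n=0..m. walk_prob \<omega> n 0 (x + 1)) * (1 - \<omega> (x + 1)) =
        walk_cdf \<omega> 0 0 x - walk_cdf \<omega> (Suc m) 0 x" for m
      by (simp only: sum_subtractf sum_distrib_right)
    have "A m x * \<omega> x - A m (x + 1) * (1 - \<omega> (x + 1)) =
        (1 / (real m + 1)) * (walk_cdf \<omega> 0 0 x - walk_cdf \<omega> (Suc m) 0 x)" for m
      by (simp only: A_def S[symmetric] right_diff_distrib mult.assoc)
    moreover have "\<bar>walk_cdf \<omega> 0 0 x - walk_cdf \<omega> (Suc m) 0 x\<bar> \<le> 1" for m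
      using walk_cdf_bounds[OF el, of 0 0 x] walk_cdf_bounds[OF el, of "Suc m" 0 x] by linarith
    ultimately show "\<forall>\<^sub>F m in sequentially. norm (A m x * \<omega> x - A m (x + 1) * (1 - \<omega> (x + 1))) \<le> 1 / (real m + 1)"
      by (auto simp: abs_mult intro!: always_eventually divide_right_mono simp del: walk_cdf.simps)
    show "(\<lambda>m. 1 / (real m + 1)) \<longlonglongrightarrow> 0"
      using LIMSEQ_inverse_real_of_nat by (simp add: inverse_eq_divide add.commute)
  qed
  have D_flux: "(\<lambda>m. D m x * \<omega> x - D m (x + 1) * (1 - \<omega> (x + 1))) \<longlonglongrightarrow> 0" for x
  proof -
    \<comment> \<open>By detailed balance the multiple of \<open>stat_env\<close> carries no net
      flow, so \<open>D\<close> has the same flow as \<open>A\<close>.\<close>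
    have "D m x * \<omega> x - D m (x + 1) * (1 - \<omega> (x + 1)) = A m x * \<omega> x - A m (x + 1) * (1 - \<omega> (x + 1))" for m
      using arg_cong[OF stat_env_balance[OF el, of x], of "\<lambda>t. t * A m 0"]
      by (simp add: D_def algebra_simps)
    with flux[of x] show ?thesis by simp
  qed
  \<comment> \<open>A vanishing flow transfers the limit 0 from one end of an edge to the other,
    since both coefficients are positive. The starting point is \<open>D m 0 = 0\<close>.\<close>
  have D_lim: "(\<lambda>m. D m x) \<longlonglongrightarrow> 0" for x
  proof (induction x rule: int_induct[where k = 0])
    case base
    show ?case by (simp add: D_def)
  next
    case (step1 x)
    have "(\<lambda>m. (D m x * \<omega> x - (D m x * \<omega> x - D m (x + 1) * (1 - \<omega> (x + 1)))) / (1 - \<omega> (x + 1)))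
      \<longlonglongrightarrow> (0 * \<omega> x - 0) / (1 - \<omega> (x + 1))"
      using ellipticD[OF el, of "x + 1"] by (intro tendsto_intros D_flux step1.IH) simp
    then show ?case using ellipticD[OF el, of "x + 1"] by simp
  next
    case (step2 x)
    have "(\<lambda>m. (D m x * (1 - \<omega> x) + (D m (x - 1) * \<omega> (x - 1) - D m x * (1 - \<omega> x))) / \<omega> (x - 1))
      \<longlonglongrightarrow> (0 * (1 - \<omega> x) + 0) / \<omega> (x - 1)"
      using ellipticD[OF el, of "x - 1"] D_flux[of "x - 1"] by (intro tendsto_intros step2.IH) auto
    then show ?case using ellipticD[OF el, of "x - 1"] by simp
  qed
  have A_sum: "((\<lambda>x. A m x) has_sum 1) UNIV" for m
  proof -
    have "((\<lambda>x. \<Sum>n\<in>{0..m}. walk_prob \<omega> n 0 x) has_sum (\<Sum>n\<in>{0..m}. 1)) UNIV"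
    proof (induction m)
      case 0
      show ?case using has_sum_walk_prob[of \<omega> 0 0] by (simp del: walk_prob.simps)
    next
      case (Suc m)
      show ?case unfolding sum.atLeast0_atMost_Suc
        by (intro has_sum_add Suc.IH has_sum_walk_prob)
    qed
    from has_sum_cmult_right[OF this, of "1 / (real m + 1)"] show ?thesis
      unfolding A_def by (simp add: add.commute)
  qed
  have norm_sum: "(stat_env \<omega> has_sum stat_norm \<omega>) UNIV"
    unfolding stat_norm_def using sum by simp
  have D_sum: "(\<Sum>\<^sub>\<infinity>x. D m x) = 1 - stat_norm \<omega> * A m 0" for m
  proof -
    have "((\<lambda>x. A m x + - (stat_env \<omega> x * A m 0)) has_sum (1 + - (stat_norm \<omega> * A m 0))) UNIV"
      using has_sum_cmult_left[OF norm_sum, of "A m 0"]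
      by (intro has_sum_add A_sum) (simp add: has_sum_uminus)
    then show ?thesis unfolding D_def by (simp add: infsumI)
  qed
  \<comment> \<open>Pointwise convergence alone would allow mass to escape to infinity; domination
    by \<open>2 * stat_env \<omega> x\<close> prevents this. Hence the total mass
    \<open>1 - stat_norm \<omega> * A m 0\<close> of \<open>D\<close> tends to 0, which gives the
    limit of \<open>A m 0\<close>.\<close>
  have "(\<lambda>m. \<Sum>\<^sub>\<infinity>x. D m x) \<longlonglongrightarrow> (\<Sum>\<^sub>\<infinity>x::int. 0)"
  proof (rule tendsto_infsum_dominated[OF D_lim])
    show "(\<lambda>x. 2 * stat_env \<omega> x) summable_on UNIV"
      by (intro summable_on_cmult_right sum)
    show "\<bar>D m x\<bar> \<le> 2 * stat_env \<omega> x" for m x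
    proof -
      have "stat_env \<omega> x * A m 0 \<le> stat_env \<omega> x * 1"
        using A_le[of m 0] stat_env_pos[OF el, of x] by (intro mult_left_mono) auto
      moreover have "0 \<le> stat_env \<omega> x * A m 0"
        using A_nonneg[of m 0] stat_env_pos[OF el, of x] by simp
      ultimately show ?thesis
        using A_nonneg[of m x] A_le[of m x] unfolding D_def by linarith
    qed
  qed
  then have lim: "(\<lambda>m. 1 - stat_norm \<omega> * A m 0) \<longlonglongrightarrow> 0"
    by (simp add: D_sum)
  have "stat_norm \<omega> \<ge> stat_env \<omega> 0"
    using has_sum_mono_neutral[OF has_sum_finite[of "{0}" "stat_env \<omega>"] norm_sum]
      stat_env_pos[OF el] by (simp add: less_imp_le)
  then have pos: "stat_norm \<omega> > 0" by simp
  have "(\<lambda>m. (1 - (1 - stat_norm \<omega> * A m 0)) / stat_norm \<omega>) \<longlonglongrightarrow> (1 - 0) / stat_norm \<omega>"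
    using pos by (intro tendsto_intros lim) simp
  then have A0: "(\<lambda>m. A m 0) \<longlonglongrightarrow> inverse (stat_norm \<omega>)"
    using pos by (simp add: inverse_eq_divide)
  have "(\<lambda>m. D m x + stat_env \<omega> x * A m 0) \<longlonglongrightarrow> 0 + stat_env \<omega> x * inverse (stat_norm \<omega>)"
    by (intro tendsto_intros D_lim A0)
  then show ?thesis by (simp add: D_def A_def)
qed

section \<open>Normalisation and symmetry\<close>

lemma measurable_stat_env [measurable]: "(\<lambda>\<omega>. stat_env \<omega> x) \<in> borel_measurable (env_law \<Delta>)"
  unfolding stat_env_def by simp

text \<open>Joint measurability comes for free with a countable index, and the sum, read as an
  integral for the counting measure, is then measurable in its parameter.\<close>

lemma measurable_stat_norm [measurable]: "stat_norm \<in> borel_measurable (env_law \<Delta>)"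
proof -
  interpret sigma_finite_measure "count_space (UNIV :: int set)"
    by (rule sigma_finite_measure_count_space)
  have "(\<lambda>(x, \<omega>). stat_env \<omega> x) \<in> borel_measurable (count_space UNIV \<Otimes>\<^sub>M env_law \<Delta>)"
    by (rule measurable_pair_measure_countable1) auto
  then have "(\<lambda>(\<omega>, x). stat_env \<omega> x) \<in> borel_measurable (env_law \<Delta> \<Otimes>\<^sub>M count_space UNIV)"
    by (subst measurable_pair_swap_iff) (simp add: case_prod_unfold)
  then have "(\<lambda>\<omega>. \<integral>x. stat_env \<omega> x \<partial>count_space UNIV) \<in> borel_measurable (env_law \<Delta>)"
    by (intro borel_measurable_lebesgue_integral) simp
  then show ?thesis
    by (simp add: stat_norm_def[abs_def] infsum_eq_integral_count_space)
qed

lemma stat_env_flip: "stat_env (env_flip \<omega>) x = stat_env \<omega> (- x)"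
proof -
  consider "x > 0" | "x = 0" | "x < 0" by linarith
  then show ?thesis
  proof cases
    case 1
    have "(\<Prod>i\<in>{1..x - 1}. (1 - \<omega> (- i)) / \<omega> (- i)) = (\<Prod>i\<in>{- x + 1..-1}. (1 - \<omega> i) / \<omega> i)"
      by (rule prod.reindex_bij_witness[of _ uminus uminus]) auto
    with 1 show ?thesis by (simp add: stat_env_def env_flip_def)
  next
    case 3
    have "(\<Prod>i\<in>{x + 1..-1}. \<omega> (- i) / (1 - \<omega> (- i))) = (\<Prod>i\<in>{1..- x - 1}. \<omega> i / (1 - \<omega> i))"
      by (rule prod.reindex_bij_witness[of _ uminus uminus]) auto
    with 3 show ?thesis by (simp add: stat_env_def env_flip_def)
  qed simp
qed

lemma stat_norm_flip: "stat_norm (env_flip \<omega>) = stat_norm \<omega>"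
  unfolding stat_norm_def stat_env_flip
  by (rule infsum_reindex_bij_betw) (rule bij_uminus)

text \<open>Mirroring the environment keeps its law and the normalisation and turns the mass at
  \<open>x\<close> into the mass at \<open>- x\<close>.\<close>

lemma limit_mass_uminus:
  assumes "\<Delta> > 0"
  shows "limit_mass \<Delta> (- x) = limit_mass \<Delta> x"
proof -
  have "limit_mass \<Delta> x = (\<integral>\<omega>. stat_env \<omega> x * inverse (stat_norm \<omega>) \<partial>distr (env_law \<Delta>) (env_law \<Delta>) env_flip)"
    by (simp add: limit_mass_def distr_env_flip[OF assms])
  also have "\<dots> = (\<integral>\<omega>. stat_env (env_flip \<omega>) x * inverse (stat_norm (env_flip \<omega>)) \<partial>env_law \<Delta>)"
    by (rule integral_distr) auto
  finally show ?thesis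
    by (simp add: limit_mass_def stat_env_flip stat_norm_flip)
qed

lemma stat_norm_ge:
  assumes "elliptic \<omega>" "stat_env \<omega> summable_on UNIV"
  shows "stat_env \<omega> x \<le> stat_norm \<omega>"
proof -
  have "sum (stat_env \<omega>) {x} \<le> stat_norm \<omega>"
    unfolding stat_norm_def using assms stat_env_pos[OF assms(1)]
    by (intro finite_sum_le_infsum) (auto simp: less_imp_le)
  then show ?thesis by simp
qed

lemma stat_norm_nonneg: "elliptic \<omega> \<Longrightarrow> 0 \<le> stat_norm \<omega>"
  unfolding stat_norm_def by (intro infsum_nonneg) (auto simp: less_imp_le stat_env_pos)

lemma stationary_mass_bounds:
  assumes "elliptic \<omega>"
  shows "0 \<le> stat_env \<omega> x * inverse (stat_norm \<omega>)" "stat_env \<omega> x * inverse (stat_norm \<omega>) \<le> 1"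
    "stat_env \<omega> x * inverse (stat_norm \<omega>) \<le> stat_env \<omega> x powr (1 / 4)"
proof -
  let ?m = "stat_env \<omega> x" and ?Z = "stat_norm \<omega>"
  have m: "?m > 0" by (rule stat_env_pos[OF assms])
  show "0 \<le> ?m * inverse ?Z"
    using m stat_norm_nonneg[OF assms] by simp
  have "?m * inverse ?Z \<le> 1 \<and> ?m * inverse ?Z \<le> ?m"
  proof (cases "stat_env \<omega> summable_on UNIV")
    case True
    have "?m \<le> ?Z" "1 \<le> ?Z"
      using stat_norm_ge[OF assms True, of x] stat_norm_ge[OF assms True, of 0] by auto
    with m show ?thesis by (simp add: field_simps)
  next
    \<comment> \<open>For a divergent series \<open>stat_norm\<close> is 0 by convention, and so is
      the quotient.\<close>
    case False
    then have "?Z = 0" by (simp add: stat_norm_def infsum_not_exists)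
    with m show ?thesis by simp
  qed
  moreover have "?m \<le> ?m powr (1 / 4)" if "?m \<le> 1"
    using powr_mono'[of "1 / 4" 1 ?m] m that by simp
  moreover have "1 \<le> ?m powr (1 / 4)" if "1 \<le> ?m"
    using ge_one_powr_ge_zero[of ?m "1 / 4"] that by simp
  ultimately show "?m * inverse ?Z \<le> 1" "?m * inverse ?Z \<le> ?m powr (1 / 4)"
    by linarith+
qed

section \<open>Exponential decay\<close>

text \<open>The \<open>s\<close>-th moment of \<open>\<omega> x / (1 - \<omega> x)\<close> for \<open>x > 0\<close>, with \<open>a = 1 / (2 * \<Delta>)\<close>, is
  \<open>Gamma (a + s) * Gamma (a + 1 / 2 - s) / (Gamma a * Gamma (a + 1 / 2))\<close>. The choice \<open>s = 1 / 4\<close> minimises it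
  and makes it smaller than 1 because the Gamma function is strictly log-convex.\<close>

definition decay_ratio :: "real \<Rightarrow> real" where
  "decay_ratio \<Delta> = Beta (1 / (2 * \<Delta>) + 1 / 4) (1 / (2 * \<Delta>) + 1 / 4) / Beta (1 / (2 * \<Delta>)) (1 / (2 * \<Delta>) + 1 / 2)"

lemma decay_ratio_pos: "\<Delta> > 0 \<Longrightarrow> decay_ratio \<Delta> > 0"
  unfolding decay_ratio_def by (intro divide_pos_pos Beta_pos) (auto intro: add_pos_pos)

text \<open>Both Beta functions have parameter sum \<open>1 / \<Delta> + 1 / 2\<close>, so the Gamma
  factor of the sum cancels.\<close>

lemma decay_ratio_Gamma:
  "\<Delta> > 0 \<Longrightarrow> decay_ratio \<Delta> = Gamma (1 / (2 * \<Delta>) + 1 / 4) ^ 2 / (Gamma (1 / (2 * \<Delta>)) * Gamma (1 / (2 * \<Delta>) + 1 / 2))"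
  unfolding decay_ratio_def Beta_def using Gamma_real_pos[of "1 / \<Delta> + 1 / 2"]
  by (simp add: power2_eq_square add.assoc add.left_commute add_pos_pos less_imp_neq[THEN not_sym])

text \<open>Strict convexity of \<open>ln_Gamma\<close> at a midpoint: the mean value theorem on the
  two halves of the interval gives intermediate points \<open>u < v\<close>, and
  \<open>Digamma\<close> is strictly increasing.\<close>

lemma Gamma_midpoint_strict:
  fixes a h :: real
  assumes "a > 0" "h > 0"
  shows "Gamma (a + h) ^ 2 < Gamma a * Gamma (a + 2 * h)"
proof -
  have D: "(ln_Gamma has_field_derivative Digamma x) (at x)" if "a \<le> x" for x :: real
    using that assms by (intro has_field_derivative_ln_Gamma_real) auto
  obtain u where u: "a < u" "u < a + h" "ln_Gamma (a + h) - ln_Gamma a = (a + h - a) * Digamma u"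
    using MVT2[of a "a + h" ln_Gamma Digamma] D assms by auto
  obtain v where v: "a + h < v" "v < a + 2 * h"
      "ln_Gamma (a + 2 * h) - ln_Gamma (a + h) = (a + 2 * h - (a + h)) * Digamma v"
    using MVT2[of "a + h" "a + 2 * h" ln_Gamma Digamma] D assms by auto
  have "Digamma u < Digamma v"
    using u v assms by (intro Digamma_real_strict_mono) auto
  then have "h * Digamma u < h * Digamma v" using assms by simp
  then have "2 * ln_Gamma (a + h) < ln_Gamma a + ln_Gamma (a + 2 * h)"
    using u(3) v(3) by (simp add: algebra_simps)
  moreover have "Gamma a \<noteq> 0" "Gamma (a + 2 * h) \<noteq> 0"
    using assms by (rule_tac [!] Gamma_real_pos[THEN less_imp_neq, THEN not_sym]) (simp_all add: add_pos_pos)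
  ultimately have "ln (Gamma (a + h) ^ 2) < ln (Gamma a * Gamma (a + 2 * h))"
    using assms by (simp add: ln_Gamma_real_pos ln_mult ln_realpow add_pos_pos)
  moreover have "0 < Gamma (a + h) ^ 2"
    using assms by (intro zero_less_power Gamma_real_pos) simp
  moreover have "0 < Gamma a * Gamma (a + 2 * h)"
    using assms by (intro mult_pos_pos Gamma_real_pos) simp_all
  ultimately show ?thesis by (simp only: ln_less_cancel_iff)
qed

lemma decay_ratio_less_1:
  assumes "\<Delta> > 0"
  shows "decay_ratio \<Delta> < 1"
  using Gamma_midpoint_strict[of "1 / (2 * \<Delta>)" "1 / 4"] assms
  by (simp add: decay_ratio_Gamma add_pos_pos)

text \<open>As \<open>\<Delta>\<close> grows, \<open>1 / (2 * \<Delta>)\<close> approaches the pole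
  of Gamma at 0. Writing \<open>Gamma a\<close> as \<open>Gamma (a + 1) / a\<close> moves the pole
  into the explicit factor \<open>a\<close>, and all other factors converge to nonzero
  limits.\<close>

lemma decay_ratio_tendsto_0: "(decay_ratio \<longlongrightarrow> 0) at_top"
proof -
  let ?a = "\<lambda>\<Delta>::real. 1 / (2 * \<Delta>)"
  have a: "(?a \<longlongrightarrow> 0) at_top" by real_asymp
  have "((\<lambda>\<Delta>. Gamma (?a \<Delta> + 1 / 4) ^ 2 * ?a \<Delta> / (Gamma (?a \<Delta> + 1) * Gamma (?a \<Delta> + 1 / 2))) \<longlongrightarrow>
    Gamma (0 + 1 / 4) ^ 2 * 0 / (Gamma (0 + 1) * Gamma (0 + 1 / 2))) at_top"
    by (intro tendsto_intros a) (auto simp: Gamma_eq_zero_iff dest!: nonpos_Ints_nonpos)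
  moreover have "\<forall>\<^sub>F \<Delta> in at_top. Gamma (?a \<Delta> + 1 / 4) ^ 2 * ?a \<Delta> / (Gamma (?a \<Delta> + 1) * Gamma (?a \<Delta> + 1 / 2)) = decay_ratio \<Delta>"
    using eventually_gt_at_top[of 0]
  proof eventually_elim
    case (elim \<Delta>)
    have "Gamma (?a \<Delta> + 1) = ?a \<Delta> * Gamma (?a \<Delta>)"
      using elim by (intro Gamma_plus1) (auto dest!: nonpos_Ints_nonpos)
    with elim show ?case by (simp add: decay_ratio_Gamma)
  qed
  ultimately show ?thesis
    by (simp add: tendsto_cong)
qed

lemma nn_integral_stat_env_powr_pos:
  assumes D: "\<Delta> > 0" and x: "x > 0"
  shows "(\<integral>\<^sup>+ \<omega>. ennreal (stat_env \<omega> x powr (1 / 4)) \<partial>env_law \<Delta>) \<le>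
    ennreal (Beta (1 / (2 * \<Delta>)) (1 / (2 * \<Delta>) + 1 / 4) / Beta (1 / (2 * \<Delta>)) (1 / (2 * \<Delta>) + 1 / 2) * decay_ratio \<Delta> ^ nat (x - 1))"
proof -
  \<comment> \<open>The site \<open>x\<close> enters \<open>stat_env \<omega> x\<close> only through
    \<open>1 / (1 - \<omega> x)\<close>, without a numerator; hence the exponent 0 there.\<close>
  define s where "s i = (if i = x then 0 else 1 / 4 :: real)" for i
  define f where "f i y = ennreal (y powr s i * (1 - y) powr (- 1 / 4))" for i y
  let ?a = "1 / (2 * \<Delta>)"
  have a: "?a > 0" using D by simp
  have site: "site_law \<Delta> i = beta_measure ?a (?a + 1 / 2)" if "i > 0" for i
    using that D by (simp add: site_law_def add_divide_distrib)
  have f: "(\<integral>\<^sup>+ y. f i y \<partial>site_law \<Delta> i) = ennreal (Beta (?a + s i) (?a + 1 / 4) / Beta ?a (?a + 1 / 2))"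
    if "i > 0" for i
  proof -
    have "?a + s i > 0" "?a + 1 / 2 + - 1 / 4 = ?a + 1 / 4"
      using a by (auto simp: s_def add_pos_nonneg)
    with a nn_integral_beta_measure_powr[of ?a "?a + 1 / 2" "s i" "- 1 / 4"] show ?thesis
      unfolding f_def site[OF that] by (simp only: add_pos_pos zero_less_divide_1_iff zero_less_numeral simp_thms)
  qed
  have X: "{1..x} = insert x {1..x - 1}" using x by auto
  have "(\<integral>\<^sup>+ \<omega>. ennreal (stat_env \<omega> x powr (1 / 4)) \<partial>env_law \<Delta>) \<le>
      (\<integral>\<^sup>+ \<omega>. (\<Prod>i\<in>{1..x}. f i (\<omega> i)) \<partial>env_law \<Delta>)"
  proof (rule nn_integral_mono_AE, use AE_env_law[OF D] in eventually_elim)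
    case (elim \<omega>)
    have *: "(\<omega> i / (1 - \<omega> i)) powr (1 / 4) = \<omega> i powr s i * (1 - \<omega> i) powr (- 1 / 4)" if "i \<noteq> x" for i
      using elim[rule_format, of i] that by (simp add: s_def powr_divide powr_minus_divide)
    \<comment> \<open>Bounding \<open>\<omega> 0\<close> by 1 removes the root, so that the
      remaining sites all have the same law.\<close>
    have "stat_env \<omega> x \<le> 1 / (1 - \<omega> x) * (\<Prod>i\<in>{1..x - 1}. \<omega> i / (1 - \<omega> i))"
    proof -
      have "\<omega> 0 / (1 - \<omega> x) * (\<Prod>i\<in>{1..x - 1}. \<omega> i / (1 - \<omega> i)) \<le> 1 / (1 - \<omega> x) * (\<Prod>i\<in>{1..x - 1}. \<omega> i / (1 - \<omega> i))"
        using elim by (intro mult_right_mono divide_right_mono prod_nonneg) (auto simp: less_imp_le)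
      then show ?thesis using x by (simp add: stat_env_def)
    qed
    then have "stat_env \<omega> x powr (1 / 4) \<le> (1 / (1 - \<omega> x) * (\<Prod>i\<in>{1..x - 1}. \<omega> i / (1 - \<omega> i))) powr (1 / 4)"
      using stat_env_pos[of \<omega> x] elim by (intro powr_mono2) (auto simp: elliptic_def)
    also have "\<dots> = (1 / (1 - \<omega> x)) powr (1 / 4) * (\<Prod>i\<in>{1..x - 1}. (\<omega> i / (1 - \<omega> i)) powr (1 / 4))"
      using elim by (subst powr_mult) (auto intro!: prod_nonneg divide_nonneg_nonneg simp: less_imp_le prod_powr_distrib)
    also have "\<dots> = (\<Prod>i\<in>{1..x}. \<omega> i powr s i * (1 - \<omega> i) powr (- 1 / 4))"
      unfolding X using elim[rule_format, of x] by (simp add: * s_def powr_divide powr_minus_divide)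
    finally show "ennreal (stat_env \<omega> x powr (1 / 4)) \<le> (\<Prod>i\<in>{1..x}. f i (\<omega> i))"
      by (simp add: f_def prod_ennreal ennreal_leI)
  qed
  also have "\<dots> = (\<Prod>i\<in>{1..x}. \<integral>\<^sup>+ y. f i y \<partial>site_law \<Delta> i)"
    by (rule nn_integral_env_law_prod[OF D]) (auto simp: f_def)
  also have "\<dots> = (\<Prod>i\<in>{1..x}. ennreal (Beta (?a + s i) (?a + 1 / 4) / Beta ?a (?a + 1 / 2)))"
    using f by (intro prod.cong) auto
  also have "\<dots> = ennreal (\<Prod>i\<in>{1..x}. Beta (?a + s i) (?a + 1 / 4) / Beta ?a (?a + 1 / 2))"
    using a by (intro prod_ennreal divide_nonneg_nonneg less_imp_le[OF Beta_pos]) (auto simp: s_def add_pos_pos)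
  also have "(\<Prod>i\<in>{1..x}. Beta (?a + s i) (?a + 1 / 4) / Beta ?a (?a + 1 / 2)) =
      Beta ?a (?a + 1 / 4) / Beta ?a (?a + 1 / 2) * (\<Prod>i\<in>{1..x - 1}. Beta (?a + 1 / 4) (?a + 1 / 4) / Beta ?a (?a + 1 / 2))"
    unfolding X by (simp add: s_def)
  finally show ?thesis by (simp add: decay_ratio_def)
qed

text \<open>The division by \<open>decay_ratio\<close> pays for the exponent
  \<open>nat \<bar>x\<bar>\<close> in place of \<open>nat (x - 1)\<close>; the maximum with 1 covers
  \<open>x = 0\<close>, where the moment is 1.\<close>

definition decay_const :: "real \<Rightarrow> real" where
  "decay_const \<Delta> = max 1 (Beta (1 / (2 * \<Delta>)) (1 / (2 * \<Delta>) + 1 / 4) / Beta (1 / (2 * \<Delta>)) (1 / (2 * \<Delta>) + 1 / 2) / decay_ratio \<Delta>)"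

lemma decay_const_pos: "decay_const \<Delta> > 0"
  by (simp add: decay_const_def)

lemma nn_integral_stat_env_powr:
  assumes D: "\<Delta> > 0"
  shows "(\<integral>\<^sup>+ \<omega>. ennreal (stat_env \<omega> x powr (1 / 4)) \<partial>env_law \<Delta>) \<le> ennreal (decay_const \<Delta> * decay_ratio \<Delta> ^ nat \<bar>x\<bar>)"
proof -
  interpret prob_space "env_law \<Delta>" by (rule prob_space_env_law[OF D])
  have pos: "(\<integral>\<^sup>+ \<omega>. ennreal (stat_env \<omega> x powr (1 / 4)) \<partial>env_law \<Delta>) \<le> ennreal (decay_const \<Delta> * decay_ratio \<Delta> ^ nat \<bar>x\<bar>)"
    if "x > 0" for x
  proof -
    let ?K = "Beta (1 / (2 * \<Delta>)) (1 / (2 * \<Delta>) + 1 / 4) / Beta (1 / (2 * \<Delta>)) (1 / (2 * \<Delta>) + 1 / 2)"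
    have "nat \<bar>x\<bar> = Suc (nat (x - 1))" using that by auto
    then have "?K * decay_ratio \<Delta> ^ nat (x - 1) = ?K / decay_ratio \<Delta> * decay_ratio \<Delta> ^ nat \<bar>x\<bar>"
      using decay_ratio_pos[OF D] by simp
    also have "\<dots> \<le> decay_const \<Delta> * decay_ratio \<Delta> ^ nat \<bar>x\<bar>"
      using decay_ratio_pos[OF D] by (intro mult_right_mono) (auto simp: decay_const_def)
    finally show ?thesis
      using nn_integral_stat_env_powr_pos[OF D that] by (meson ennreal_leI order_trans)
  qed
  consider "x > 0" | "x = 0" | "x < 0" by linarith
  then show ?thesis
  proof cases
    case 2
    then show ?thesis using emeasure_space_1 by (simp add: decay_const_def)
  next
    case 3
    have "(\<integral>\<^sup>+ \<omega>. ennreal (stat_env \<omega> (- x) powr (1 / 4)) \<partial>env_law \<Delta>) =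
      (\<integral>\<^sup>+ \<omega>. ennreal (stat_env \<omega> (- x) powr (1 / 4)) \<partial>distr (env_law \<Delta>) (env_law \<Delta>) env_flip)"
      by (simp add: distr_env_flip[OF D])
    also have "\<dots> = (\<integral>\<^sup>+ \<omega>. ennreal (stat_env (env_flip \<omega>) (- x) powr (1 / 4)) \<partial>env_law \<Delta>)"
      by (rule nn_integral_distr) auto
    finally show ?thesis using pos[of "- x"] 3 by (simp add: stat_env_flip)
  qed (rule pos)
qed

section \<open>Geometric series with polynomial weights over the integers\<close>

lemma times_power_le:
  fixes q :: real
  assumes "0 \<le> q" "q < 1"
  shows "real n * q ^ n \<le> 1 / (1 - q)"
proof -
  have "real n * q ^ n = (\<Sum>i<n. q ^ n)" by simp
  \<comment> \<open>Every one of the first \<open>n\<close> terms of the geometric series is at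
    least \<open>q ^ n\<close>.\<close>
  also have "\<dots> \<le> (\<Sum>i<n. q ^ i)"
    using assms by (intro sum_mono power_decreasing) auto
  also have "\<dots> = (1 - q ^ n) / (1 - q)"
    using assms by (simp add: sum_gp_strict)
  also have "\<dots> \<le> 1 / (1 - q)"
    using assms by (intro divide_right_mono) auto
  finally show ?thesis .
qed

lemma summable_power_times_power:
  fixes r :: real
  assumes "0 < r" "r < 1"
  shows "summable (\<lambda>n. real n ^ k * r ^ n)"
proof -
  \<comment> \<open>With \<open>r = q ^ Suc k\<close>, each of \<open>k\<close> factors
    \<open>q ^ n\<close> absorbs one factor \<open>n\<close>, and the last one leaves a geometric
    series.\<close>
  define q where "q = root (Suc k) r"
  have q: "0 < q" "q < 1" "q ^ Suc k = r"
    using assms by (auto simp: q_def real_root_gt_zero simp del: power_Suc)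
  show ?thesis
  proof (rule summable_comparison_test)
    show "summable (\<lambda>n. (1 / (1 - q)) ^ k * q ^ n)"
      using q by (intro summable_mult summable_geometric) auto
    have "norm (real n ^ k * r ^ n) \<le> (1 / (1 - q)) ^ k * q ^ n" for n
    proof -
      have "real n ^ k * r ^ n = (real n * q ^ n) ^ k * q ^ n"
        by (simp add: q(3)[symmetric] power_mult_distrib power_mult[symmetric] mult.commute)
      also have "\<dots> \<le> (1 / (1 - q)) ^ k * q ^ n"
        using q by (intro mult_right_mono power_mono times_power_le) auto
      finally show ?thesis using assms by simp
    qed
    then show "\<exists>N. \<forall>n\<ge>N. norm (real n ^ k * r ^ n) \<le> (1 / (1 - q)) ^ k * q ^ n" by blast
  qed
qed

lemma summable_on_int_power_times_power:
  fixes r :: real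
  assumes "0 < r" "r < 1"
  shows "(\<lambda>x::int. \<bar>real_of_int x\<bar> ^ k * r ^ nat \<bar>x\<bar>) summable_on UNIV"
proof -
  let ?f = "\<lambda>x::int. \<bar>real_of_int x\<bar> ^ k * r ^ nat \<bar>x\<bar>"
  have nat: "(\<lambda>n. real n ^ k * r ^ n) summable_on UNIV"
    using summable_power_times_power[OF assms, of k] assms
    by (intro norm_summable_imp_summable_on) simp
  have "?f summable_on range int"
    using nat by (subst summable_on_reindex) (auto simp: o_def)
  moreover have "?f summable_on range (\<lambda>n. - int n)"
    using nat by (subst summable_on_reindex) (auto simp: o_def inj_def)
  ultimately have "?f summable_on (range int \<union> range (\<lambda>n. - int n))"
    by (rule summable_on_union)
  moreover have "range int \<union> range (\<lambda>n. - int n) = UNIV"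
    by (auto simp: image_iff) (metis int_cases2)
  ultimately show ?thesis by simp
qed

lemma nn_integral_int_geometric_finite:
  fixes r :: real
  assumes "0 < r" "r < 1" "0 < c"
  shows "(\<integral>\<^sup>+ x. ennreal (c * r ^ nat \<bar>x\<bar>) \<partial>count_space (UNIV :: int set)) < \<infinity>"
proof -
  have "integrable (count_space UNIV) (\<lambda>x::int. c * r ^ nat \<bar>x\<bar>)"
    using summable_on_int_power_times_power[OF assms(1,2), of 0]
    by (intro integrable_mult_right) (simp add: summable_on_iff_integrable_count_space)
  then have "(\<integral>\<^sup>+ x. ennreal (c * r ^ nat \<bar>x\<bar>) \<partial>count_space (UNIV :: int set)) =
      ennreal (\<integral>x. c * r ^ nat \<bar>x\<bar> \<partial>count_space (UNIV :: int set))"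
    using assms by (intro nn_integral_eq_integral) auto
  then show ?thesis by simp
qed

text \<open>By Tonelli the sum of the fractional powers has finite expectation and is therefore
  almost surely finite. First moments would not serve: for \<open>x > 0\<close> the mean of
  \<open>\<omega> x / (1 - \<omega> x)\<close> is \<open>1 / (1 - \<Delta>)\<close> for
  \<open>\<Delta> < 1\<close> and infinite otherwise.\<close>

lemma AE_summable_stat_env:
  assumes D: "\<Delta> > 0"
  shows "AE \<omega> in env_law \<Delta>. elliptic \<omega> \<and> stat_env \<omega> summable_on UNIV"
proof -
  let ?s = "\<lambda>\<omega> x. stat_env \<omega> x powr (1 / 4)"
  have "(\<integral>\<^sup>+ \<omega>. \<integral>\<^sup>+ x. ennreal (?s \<omega> x) \<partial>count_space UNIV \<partial>env_law \<Delta>) =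
      (\<integral>\<^sup>+ x. \<integral>\<^sup>+ \<omega>. ennreal (?s \<omega> x) \<partial>env_law \<Delta> \<partial>count_space UNIV)"
    by (rule nn_integral_count_space_nn_integral) auto
  also have "\<dots> \<le> (\<integral>\<^sup>+ x. ennreal (decay_const \<Delta> * decay_ratio \<Delta> ^ nat \<bar>x\<bar>) \<partial>count_space UNIV)"
    by (intro nn_integral_mono nn_integral_stat_env_powr D)
  also have "\<dots> < \<infinity>"
    using decay_ratio_pos[OF D] decay_ratio_less_1[OF D] decay_const_pos
    by (rule nn_integral_int_geometric_finite)
  finally have fin: "(\<integral>\<^sup>+ \<omega>. \<integral>\<^sup>+ x. ennreal (?s \<omega> x) \<partial>count_space UNIV \<partial>env_law \<Delta>) \<noteq> \<infinity>" by simp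
  have m: "(\<lambda>\<omega>. \<integral>\<^sup>+ x. ennreal (?s \<omega> x) \<partial>count_space UNIV) \<in> borel_measurable (env_law \<Delta>)"
  proof -
    interpret sigma_finite_measure "count_space (UNIV :: int set)"
      by (rule sigma_finite_measure_count_space)
    have "(\<lambda>(x, \<omega>). ennreal (?s \<omega> x)) \<in> borel_measurable (count_space UNIV \<Otimes>\<^sub>M env_law \<Delta>)"
      by (rule measurable_pair_measure_countable1) auto
    then have "(\<lambda>(\<omega>, x). ennreal (?s \<omega> x)) \<in> borel_measurable (env_law \<Delta> \<Otimes>\<^sub>M count_space UNIV)"
      by (subst measurable_pair_swap_iff) (simp add: case_prod_unfold)
    then show ?thesis
      by (intro borel_measurable_nn_integral) simp
  qed
  have "AE \<omega> in env_law \<Delta>. (\<integral>\<^sup>+ x. ennreal (?s \<omega> x) \<partial>count_space UNIV) \<noteq> \<infinity>"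
    by (rule nn_integral_PInf_AE[OF m fin])
  with AE_env_law[OF D] show ?thesis
  proof eventually_elim
    case (elim \<omega>)
    then have el: "elliptic \<omega>" by (simp add: elliptic_def)
    have "integrable (count_space UNIV) (?s \<omega>)"
      using elim by (intro integrableI_nonneg) (auto simp: top.not_eq_extremum)
    then have s: "?s \<omega> summable_on UNIV"
      by (simp add: summable_on_iff_integrable_count_space)
    define S where "S = infsum (?s \<omega>) UNIV"
    have s_le: "?s \<omega> x \<le> S" for x
      using finite_sum_le_infsum[OF s, of "{x}"] by (simp add: S_def)
    have "stat_env \<omega> summable_on UNIV"
    proof (rule summable_on_comparison_test)
      show "(\<lambda>x. S ^ 3 * ?s \<omega> x) summable_on UNIV"
        by (intro summable_on_cmult_right s)
      show "stat_env \<omega> x \<le> S ^ 3 * ?s \<omega> x" for x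
      proof -
        have "stat_env \<omega> x = ?s \<omega> x ^ 3 * ?s \<omega> x"
          using stat_env_pos[OF el, of x]
          by (simp add: powr_power powr_add[symmetric] flip: power_Suc2)
        also have "\<dots> \<le> S ^ 3 * ?s \<omega> x"
          by (intro mult_right_mono power_mono s_le) auto
        finally show ?thesis .
      qed
    qed (use stat_env_pos[OF el] in \<open>auto simp: less_imp_le\<close>)
    with el show ?case by blast
  qed
qed

section \<open>The limit law\<close>

lemma AE_elliptic: "\<Delta> > 0 \<Longrightarrow> AE \<omega> in env_law \<Delta>. elliptic \<omega>"
  using AE_env_law by (simp add: elliptic_def)

lemma integrable_limit_mass:
  assumes D: "\<Delta> > 0"
  shows "integrable (env_law \<Delta>) (\<lambda>\<omega>. stat_env \<omega> x * inverse (stat_norm \<omega>))"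
proof -
  interpret prob_space "env_law \<Delta>" by (rule prob_space_env_law[OF D])
  show ?thesis
  proof (rule integrable_const_bound[where B = 1])
    show "AE \<omega> in env_law \<Delta>. norm (stat_env \<omega> x * inverse (stat_norm \<omega>)) \<le> 1"
      using AE_elliptic[OF D]
    proof eventually_elim
      case (elim \<omega>)
      then show ?case
        using stationary_mass_bounds(1,2)[of \<omega> x] by (simp only: real_norm_def abs_of_nonneg)
    qed
  qed simp
qed

lemma ennreal_limit_mass:
  assumes D: "\<Delta> > 0"
  shows "ennreal (limit_mass \<Delta> x) = (\<integral>\<^sup>+ \<omega>. ennreal (stat_env \<omega> x * inverse (stat_norm \<omega>)) \<partial>env_law \<Delta>)"
  unfolding limit_mass_def
  by (rule nn_integral_eq_integral[symmetric, OF integrable_limit_mass[OF D]])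
     (use AE_elliptic[OF D] in eventually_elim, rule stationary_mass_bounds(1))

lemma limit_mass_pos:
  assumes D: "\<Delta> > 0"
  shows "limit_mass \<Delta> x > 0"
proof -
  interpret prob_space "env_law \<Delta>" by (rule prob_space_env_law[OF D])
  have pos: "AE \<omega> in env_law \<Delta>. 0 < stat_env \<omega> x * inverse (stat_norm \<omega>)"
    \<comment> \<open>Summability matters here: for a divergent series the quotient would be 0 by
      convention.\<close>
    using AE_summable_stat_env[OF D]
  proof eventually_elim
    case (elim \<omega>)
    then have "0 < stat_norm \<omega>"
      using stat_norm_ge[of \<omega> 0] by simp
    with elim show ?case by (simp add: stat_env_pos)
  qed
  have "\<not> (AE \<omega> in env_law \<Delta>. stat_env \<omega> x * inverse (stat_norm \<omega>) = 0)"
  proof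
    assume "AE \<omega> in env_law \<Delta>. stat_env \<omega> x * inverse (stat_norm \<omega>) = 0"
    with pos have "AE \<omega> in env_law \<Delta>. False" by eventually_elim simp
    then show False by simp
  qed
  then have "limit_mass \<Delta> x \<noteq> 0"
    unfolding limit_mass_def
    by (subst integral_nonneg_eq_0_iff_AE[OF integrable_limit_mass[OF D]]) (use pos in \<open>auto simp: less_imp_le\<close>)
  moreover have "limit_mass \<Delta> x \<ge> 0"
    unfolding limit_mass_def by (rule integral_nonneg_AE) (use pos in \<open>auto simp: less_imp_le\<close>)
  ultimately show ?thesis by simp
qed

lemma limit_mass_le:
  assumes D: "\<Delta> > 0"
  shows "limit_mass \<Delta> x \<le> decay_const \<Delta> * decay_ratio \<Delta> ^ nat \<bar>x\<bar>"
proof -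
  have "ennreal (limit_mass \<Delta> x) \<le> (\<integral>\<^sup>+ \<omega>. ennreal (stat_env \<omega> x powr (1 / 4)) \<partial>env_law \<Delta>)"
    unfolding ennreal_limit_mass[OF D]
    by (intro nn_integral_mono_AE, use AE_elliptic[OF D] in eventually_elim)
       (intro ennreal_leI stationary_mass_bounds(3))
  also have "\<dots> \<le> ennreal (decay_const \<Delta> * decay_ratio \<Delta> ^ nat \<bar>x\<bar>)"
    by (rule nn_integral_stat_env_powr[OF D])
  finally show ?thesis
    using decay_const_pos[of \<Delta>] decay_ratio_pos[OF D] by (simp add: ennreal_le_iff)
qed

text \<open>By Tonelli the sum over the sites may be taken first, inside each environment, where the
  normalised masses almost surely add up to 1.\<close>

lemma prob_space_limit_law:
  assumes D: "\<Delta> > 0"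
  shows "prob_space (limit_law \<Delta>)"
proof (rule prob_spaceI)
  interpret prob_space "env_law \<Delta>" by (rule prob_space_env_law[OF D])
  have "emeasure (limit_law \<Delta>) (space (limit_law \<Delta>)) = (\<integral>\<^sup>+ x. ennreal (limit_mass \<Delta> x) \<partial>count_space UNIV)"
    unfolding limit_law_def by (subst emeasure_density) (auto simp: space_density)
  also have "\<dots> = (\<integral>\<^sup>+ x. \<integral>\<^sup>+ \<omega>. ennreal (stat_env \<omega> x * inverse (stat_norm \<omega>)) \<partial>env_law \<Delta> \<partial>count_space UNIV)"
    by (simp add: ennreal_limit_mass[OF D])
  also have "\<dots> = (\<integral>\<^sup>+ \<omega>. \<integral>\<^sup>+ x. ennreal (stat_env \<omega> x * inverse (stat_norm \<omega>)) \<partial>count_space UNIV \<partial>env_law \<Delta>)"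
    by (rule nn_integral_count_space_nn_integral[symmetric]) auto
  also have "\<dots> = (\<integral>\<^sup>+ \<omega>. 1 \<partial>env_law \<Delta>)"
  proof (rule nn_integral_cong_AE, use AE_summable_stat_env[OF D] in eventually_elim)
    case (elim \<omega>)
    then have Z: "0 < stat_norm \<omega>"
      using stat_norm_ge[of \<omega> 0] by simp
    have int: "integrable (count_space UNIV) (stat_env \<omega>)"
      using elim by (simp add: summable_on_iff_integrable_count_space)
    then have "(\<integral>\<^sup>+ x. ennreal (stat_env \<omega> x * inverse (stat_norm \<omega>)) \<partial>count_space UNIV) =
        ennreal (\<integral>x. stat_env \<omega> x * inverse (stat_norm \<omega>) \<partial>count_space UNIV)"
      using stationary_mass_bounds(1) elim by (intro nn_integral_eq_integral integrable_mult_left) auto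
    also have "(\<integral>x. stat_env \<omega> x * inverse (stat_norm \<omega>) \<partial>count_space UNIV) = 1"
      using Z by (simp add: infsum_eq_integral_count_space[symmetric] stat_norm_def[symmetric])
    finally show ?case by simp
  qed
  also have "\<dots> = 1" using emeasure_space_1 by simp
  finally show "emeasure (limit_law \<Delta>) (space (limit_law \<Delta>)) = 1" .
qed

section \<open>Moments of the limit law and the rate of decay\<close>

lemma integrable_limit_moment:
  assumes D: "\<Delta> > 0"
  shows "integrable (count_space UNIV) (\<lambda>x. limit_mass \<Delta> x * real_of_int x ^ n)"
proof (rule Bochner_Integration.integrable_bound)
  show "integrable (count_space UNIV) (\<lambda>x::int. decay_const \<Delta> * (\<bar>real_of_int x\<bar> ^ n * decay_ratio \<Delta> ^ nat \<bar>x\<bar>))"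
    using summable_on_int_power_times_power[OF decay_ratio_pos[OF D] decay_ratio_less_1[OF D], of n]
    by (intro integrable_mult_right) (simp add: summable_on_iff_integrable_count_space)
  have "norm (limit_mass \<Delta> x * real_of_int x ^ n) \<le>
      norm (decay_const \<Delta> * (\<bar>real_of_int x\<bar> ^ n * decay_ratio \<Delta> ^ nat \<bar>x\<bar>))" for x
    using mult_right_mono[OF limit_mass_le[OF D, of x], of "\<bar>real_of_int x\<bar> ^ n"]
      limit_mass_pos[OF D, of x] decay_const_pos[of \<Delta>] decay_ratio_pos[OF D]
    by (simp add: abs_mult power_abs mult_ac)
  then show "AE x in count_space UNIV. norm (limit_mass \<Delta> x * real_of_int x ^ n) \<le>
      norm (decay_const \<Delta> * (\<bar>real_of_int x\<bar> ^ n * decay_ratio \<Delta> ^ nat \<bar>x\<bar>))" by simp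
qed simp

lemma limit_moment_odd:
  assumes D: "\<Delta> > 0" and "odd n"
  shows "(\<integral>x. limit_mass \<Delta> x * real_of_int x ^ n \<partial>count_space UNIV) = 0"
proof -
  have "(\<integral>x. limit_mass \<Delta> x * real_of_int x ^ n \<partial>count_space UNIV) =
      (\<integral>x. limit_mass \<Delta> (- x) * real_of_int (- x) ^ n \<partial>count_space UNIV)"
    by (rule integral_bij_count_space[symmetric, OF bij_uminus])
  also have "\<dots> = - (\<integral>x. limit_mass \<Delta> x * real_of_int x ^ n \<partial>count_space UNIV)"
    using assms by (simp add: limit_mass_uminus)
  finally show ?thesis by simp
qed

lemma limit_moment_even:
  assumes D: "\<Delta> > 0" and "even n"
  shows "(\<integral>x. limit_mass \<Delta> x * real_of_int x ^ n \<partial>count_space UNIV) > 0"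
proof -
  have nn: "0 \<le> limit_mass \<Delta> x * real_of_int x ^ n" for x
    using limit_mass_pos[OF D, of x] assms(2) by (simp add: zero_le_even_power)
  have "(\<integral>x. limit_mass \<Delta> x * real_of_int x ^ n \<partial>count_space UNIV) \<noteq> 0"
    \<comment> \<open>The site 1 is the witness because \<open>x ^ n\<close> vanishes at 0 for
      \<open>n > 0\<close>.\<close>
    using limit_mass_pos[OF D, of 1]
    by (subst integral_nonneg_eq_0_iff_AE[OF integrable_limit_moment[OF D]])
       (auto simp: AE_count_space nn intro!: exI[of _ 1])
  moreover have "(\<integral>x. limit_mass \<Delta> x * real_of_int x ^ n \<partial>count_space UNIV) \<ge> 0"
    by (intro Bochner_Integration.integral_nonneg nn)
  ultimately show ?thesis by simp
qed

lemma moments_of_limit_law: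
  assumes D: "\<Delta> > 0" and Y: "Y \<in> measurable N (count_space UNIV)"
    and distr: "distr N (count_space UNIV) Y = limit_law \<Delta>"
  shows "integrable N (\<lambda>b. real_of_int (Y b) ^ n)"
    and "(\<integral>b. real_of_int (Y b) ^ n \<partial>N) = (\<integral>x. limit_mass \<Delta> x * real_of_int x ^ n \<partial>count_space UNIV)"
proof -
  have nn: "AE x in count_space UNIV. 0 \<le> limit_mass \<Delta> x"
    using limit_mass_pos[OF D] by (simp add: less_imp_le)
  have "integrable (limit_law \<Delta>) (\<lambda>x. real_of_int x ^ n)"
    unfolding limit_law_def using integrable_limit_moment[OF D, of n] nn by (subst integrable_density) auto
  then show "integrable N (\<lambda>b. real_of_int (Y b) ^ n)"
    unfolding distr[symmetric] by (subst (asm) integrable_distr_eq[OF Y]) auto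
  have "(\<integral>b. real_of_int (Y b) ^ n \<partial>N) = (\<integral>x. real_of_int x ^ n \<partial>limit_law \<Delta>)"
    unfolding distr[symmetric] by (subst integral_distr[OF Y]) auto
  also have "\<dots> = (\<integral>x. limit_mass \<Delta> x * real_of_int x ^ n \<partial>count_space UNIV)"
    unfolding limit_law_def using nn by (subst integral_density) auto
  finally show "(\<integral>b. real_of_int (Y b) ^ n \<partial>N) = (\<integral>x. limit_mass \<Delta> x * real_of_int x ^ n \<partial>count_space UNIV)" .
qed

text \<open>The minimum with \<open>\<Delta>\<close> gives the limit 0 at 0 without an asymptotic analysis of \<open>decay_ratio\<close> there.\<close>

definition decay_rate :: "real \<Rightarrow> real" where
  "decay_rate \<Delta> = min \<Delta> (- ln (decay_ratio \<Delta>))"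

lemma decay_rate_pos: "\<Delta> > 0 \<Longrightarrow> decay_rate \<Delta> > 0"
  using decay_ratio_pos decay_ratio_less_1 by (simp add: decay_rate_def)

lemma limit_mass_le_exp:
  assumes D: "\<Delta> > 0"
  shows "limit_mass \<Delta> x \<le> decay_const \<Delta> * exp (- decay_rate \<Delta> * real_of_int \<bar>x\<bar>)"
proof -
  have "decay_ratio \<Delta> ^ nat \<bar>x\<bar> = exp (ln (decay_ratio \<Delta>) * real_of_int \<bar>x\<bar>)"
    using decay_ratio_pos[OF D] by (simp add: exp_of_nat_mult[symmetric] exp_of_nat2_mult flip: powr_realpow) (simp add: powr_def mult.commute)
  also have "\<dots> \<le> exp (- decay_rate \<Delta> * real_of_int \<bar>x\<bar>)"
    by (intro exp_mono mult_right_mono) (auto simp: decay_rate_def)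
  finally show ?thesis
    using limit_mass_le[OF D, of x] decay_const_pos[of \<Delta>]
    by (meson mult_left_mono less_imp_le order_trans)
qed

lemma decay_rate_tendsto_0: "(decay_rate \<longlongrightarrow> 0) (at_right 0)"
proof (rule tendsto_sandwich)
  show "\<forall>\<^sub>F \<Delta> in at_right 0. 0 \<le> decay_rate \<Delta>"
    using eventually_at_right_less[of 0] by eventually_elim (simp add: decay_rate_pos less_imp_le)
  show "\<forall>\<^sub>F \<Delta> in at_right 0. decay_rate \<Delta> \<le> \<Delta>"
    by (simp add: decay_rate_def)
  show "((\<lambda>\<Delta>. \<Delta>) \<longlongrightarrow> 0) (at_right (0::real))" by (rule tendsto_ident_at)
qed simp

lemma decay_rate_at_top: "filterlim decay_rate at_top at_top"
proof -
  \<comment> \<open>Positivity of \<open>decay_ratio\<close> sharpens its convergence to 0 to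
    convergence from the right, where \<open>ln\<close> tends to minus infinity.\<close>
  have "filterlim decay_ratio (at_right 0) at_top"
    unfolding at_within_def
    by (intro filterlim_inf[THEN iffD2] conjI decay_ratio_tendsto_0 filterlim_principal[THEN iffD2])
       (use eventually_gt_at_top[of 0] in \<open>eventually_elim, auto dest: decay_ratio_pos\<close>)
  then have "filterlim (\<lambda>\<Delta>. ln (decay_ratio \<Delta>)) at_bot at_top"
    by (rule filterlim_compose[OF ln_at_0])
  then have "filterlim (\<lambda>\<Delta>. - ln (decay_ratio \<Delta>)) at_top at_top"
    by (simp add: filterlim_uminus_at_top)
  then show ?thesis
    by (auto simp: decay_rate_def filterlim_at_top intro: eventually_conj eventually_ge_at_top)
qed

section \<open>The reinforced walk as a mixture of walks in a fixed environment\<close>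

definition nn_path :: "(nat \<Rightarrow> int) \<Rightarrow> nat \<Rightarrow> bool" where
  "nn_path x n \<longleftrightarrow> x 0 = 0 \<and> (\<forall>i<n. x (Suc i) = x i + 1 \<or> x (Suc i) = x i - 1)"

primrec up_steps :: "(nat \<Rightarrow> int) \<Rightarrow> nat \<Rightarrow> int \<Rightarrow> nat" where
  "up_steps x 0 y = 0"
| "up_steps x (Suc n) y = up_steps x n y + of_bool (x n = y \<and> x (Suc n) = y + 1)"

primrec down_steps :: "(nat \<Rightarrow> int) \<Rightarrow> nat \<Rightarrow> int \<Rightarrow> nat" where
  "down_steps x 0 y = 0"
| "down_steps x (Suc n) y = down_steps x n y + of_bool (x n = y \<and> x (Suc n) = y - 1)"

definition step_prob :: "(int \<Rightarrow> real) \<Rightarrow> int \<Rightarrow> int \<Rightarrow> real" where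
  "step_prob \<omega> u v = (if v = u + 1 then \<omega> u else 1 - \<omega> u)"

definition path_weight :: "(int \<Rightarrow> real) \<Rightarrow> (nat \<Rightarrow> int) \<Rightarrow> nat \<Rightarrow> real" where
  "path_weight \<omega> x n = (\<Prod>i<n. step_prob \<omega> (x i) (x (Suc i)))"

lemma nn_path_SucD: "nn_path x (Suc n) \<Longrightarrow> nn_path x n"
  by (simp add: nn_path_def)

lemma nn_path_Suc_step: "nn_path x (Suc n) \<Longrightarrow> x (Suc n) = x n + 1 \<or> x (Suc n) = x n - 1"
  by (simp add: nn_path_def)

lemma nn_path_upd: "nn_path x n \<Longrightarrow> w = x n + 1 \<or> w = x n - 1 \<Longrightarrow> nn_path (x(Suc n := w)) (Suc n)"
  by (auto simp: nn_path_def less_Suc_eq)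

lemma path_weight_upd:
  "path_weight \<omega> (x(Suc n := w)) (Suc n) = path_weight \<omega> x n * step_prob \<omega> (x n) w"
  by (auto simp: path_weight_def intro!: arg_cong2[where f = "(*)"] prod.cong)

lemma edge_weight_eq:
  "edge_weight \<Delta> x n {y, y + 1} = 1 + \<Delta> * (real (up_steps x n y) + real (down_steps x n (y + 1)))"
proof -
  have "(\<Sum>i\<in>{1..n}. of_bool ({x (i - 1), x i} = {y, y + 1})) = real (up_steps x n y) + real (down_steps x n (y + 1))"
  proof (induction n)
    case (Suc n)
    have "of_bool ({x n, x (Suc n)} = {y, y + 1}) =
      (of_bool (x n = y \<and> x (Suc n) = y + 1) + of_bool (x n = y + 1 \<and> x (Suc n) = y) :: real)"
      by (auto simp: doubleton_eq_iff)
    with Suc.IH show ?case by simp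
  qed simp
  then show ?thesis by (simp add: edge_weight_def)
qed

text \<open>On a tree, every edge between the root and the current position has been crossed once more
  outwards than inwards, and every other edge equally often in both directions.\<close>

lemma steps_balance:
  "nn_path x n \<Longrightarrow> int (up_steps x n y) - int (down_steps x n (y + 1)) =
     of_bool (0 \<le> y \<and> y < x n) - of_bool (x n \<le> y \<and> y < 0)"
proof (induction n)
  case 0
  then show ?case by (simp add: nn_path_def)
next
  case (Suc n)
  note IH = Suc.IH[OF nn_path_SucD[OF Suc.prems]]
  from nn_path_Suc_step[OF Suc.prems] show ?case
  proof
    assume *: "x (Suc n) = x n + 1"
    then show ?thesis using IH by (auto simp: * of_bool_def split: if_splits)
  next
    assume *: "x (Suc n) = x n - 1"
    then show ?thesis using IH by (auto simp: * of_bool_def split: if_splits)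
  qed
qed

text \<open>By \<open>steps_balance\<close> the crossings of the upper edge number twice the up
  steps from the current site, plus one if that site is negative. So the weight depends on local
  counts only, as for a Polya urn.\<close>

lemma edge_weight_up:
  assumes "\<Delta> > 0" "nn_path x n"
  shows "edge_weight \<Delta> x n {x n, x n + 1} = 2 * \<Delta> * (site_a \<Delta> (x n) + real (up_steps x n (x n)))"
proof -
  have "int (down_steps x n (x n + 1)) = int (up_steps x n (x n)) + of_bool (x n < 0)"
    using steps_balance[OF assms(2), of "x n"] by simp
  then have "real (down_steps x n (x n + 1)) = real (up_steps x n (x n)) + of_bool (x n < 0)"
    by (auto split: if_splits simp: of_bool_def)
  then show ?thesis using assms unfolding edge_weight_eq by (simp add: site_a_def field_simps)
qed

lemma edge_weight_down:
  assumes "\<Delta> > 0" "nn_path x n"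
  shows "edge_weight \<Delta> x n {x n, x n - 1} = 2 * \<Delta> * (site_b \<Delta> (x n) + real (down_steps x n (x n)))"
proof -
  have "int (up_steps x n (x n - 1)) = int (down_steps x n (x n)) + of_bool (x n > 0)"
    using steps_balance[OF assms(2), of "x n - 1"] by simp
  then have "real (up_steps x n (x n - 1)) = real (down_steps x n (x n)) + of_bool (x n > 0)"
    by (auto split: if_splits simp: of_bool_def)
  moreover have "edge_weight \<Delta> x n {x n, x n - 1} = edge_weight \<Delta> x n {x n - 1, (x n - 1) + 1}"
    by (simp add: insert_commute)
  ultimately show ?thesis using assms unfolding edge_weight_eq by (simp add: site_b_def field_simps)
qed

text \<open>The factors along the path are regrouped by site. Allowing any finite \<open>J\<close>
  that contains the visited sites lets a path and its extension be compared over the same index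
  set.\<close>

lemma path_weight_eq_prod:
  assumes "finite J"
  shows "nn_path x n \<Longrightarrow> x ` {..<n} \<subseteq> J \<Longrightarrow>
    path_weight \<omega> x n = (\<Prod>y\<in>J. \<omega> y ^ up_steps x n y * (1 - \<omega> y) ^ down_steps x n y)"
proof (induction n)
  case 0
  show ?case by (simp add: path_weight_def)
next
  case (Suc n)
  have IH: "path_weight \<omega> x n = (\<Prod>y\<in>J. \<omega> y ^ up_steps x n y * (1 - \<omega> y) ^ down_steps x n y)"
    by (rule Suc.IH) (use Suc.prems nn_path_SucD in auto)
  have xn: "x n \<in> J" using Suc.prems by auto
  have "(\<Prod>y\<in>J. \<omega> y ^ of_bool (x n = y \<and> x (Suc n) = y + 1) * (1 - \<omega> y) ^ of_bool (x n = y \<and> x (Suc n) = y - 1)) =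
    (\<Prod>y\<in>J. if y = x n then step_prob \<omega> (x n) (x (Suc n)) else 1)"
    using nn_path_Suc_step[OF Suc.prems(1)] by (intro prod.cong) (auto simp: step_prob_def)
  also have "\<dots> = step_prob \<omega> (x n) (x (Suc n))"
    using assms xn by simp
  finally have step: "(\<Prod>y\<in>J. \<omega> y ^ of_bool (x n = y \<and> x (Suc n) = y + 1) * (1 - \<omega> y) ^ of_bool (x n = y \<and> x (Suc n) = y - 1)) =
    step_prob \<omega> (x n) (x (Suc n))" .
  have "(\<Prod>y\<in>J. \<omega> y ^ up_steps x (Suc n) y * (1 - \<omega> y) ^ down_steps x (Suc n) y) =
    (\<Prod>y\<in>J. (\<omega> y ^ up_steps x n y * (1 - \<omega> y) ^ down_steps x n y) *
      (\<omega> y ^ of_bool (x n = y \<and> x (Suc n) = y + 1) * (1 - \<omega> y) ^ of_bool (x n = y \<and> x (Suc n) = y - 1)))"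
    by (simp add: power_add mult_ac)
  also have "\<dots> = (\<Prod>y\<in>J. \<omega> y ^ up_steps x n y * (1 - \<omega> y) ^ down_steps x n y) *
    (\<Prod>y\<in>J. \<omega> y ^ of_bool (x n = y \<and> x (Suc n) = y + 1) * (1 - \<omega> y) ^ of_bool (x n = y \<and> x (Suc n) = y - 1))"
    by (rule prod.distrib)
  also have "\<dots> = path_weight \<omega> x (Suc n)"
    unfolding IH[symmetric] step by (simp add: path_weight_def)
  finally show ?case by (rule sym)
qed

lemma measurable_walk_prob [measurable]: "(\<lambda>\<omega>. walk_prob \<omega> k u v) \<in> borel_measurable (env_law \<Delta>)"
  by (induction k arbitrary: u) auto

lemma measurable_path_weight [measurable]: "(\<lambda>\<omega>. path_weight \<omega> x n) \<in> borel_measurable (env_law \<Delta>)"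
proof -
  have "(\<lambda>\<omega>. step_prob \<omega> u v) \<in> borel_measurable (env_law \<Delta>)" for u v
    by (simp add: step_prob_def)
  then show ?thesis unfolding path_weight_def by simp
qed

lemma path_weight_bounds:
  assumes "elliptic \<omega>"
  shows "0 \<le> path_weight \<omega> x n" "path_weight \<omega> x n \<le> 1"
  unfolding path_weight_def using ellipticD[OF assms]
  by (auto intro!: prod_nonneg prod_le_1 simp: step_prob_def less_imp_le)

section \<open>Path probabilities averaged over the environment\<close>

definition path_prob :: "real \<Rightarrow> (nat \<Rightarrow> int) \<Rightarrow> nat \<Rightarrow> real" where
  "path_prob \<Delta> x n = (\<integral>\<omega>. path_weight \<omega> x n \<partial>env_law \<Delta>)"

lemma path_prob_eq_prod:
  assumes D: "\<Delta> > 0" and x: "nn_path x n" and J: "finite J" "x ` {..<n} \<subseteq> J"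
  shows "path_prob \<Delta> x n = (\<Prod>y\<in>J. Beta (site_a \<Delta> y + up_steps x n y) (site_b \<Delta> y + down_steps x n y) /
    Beta (site_a \<Delta> y) (site_b \<Delta> y))" (is "_ = ?R")
proof -
  have pos: "0 \<le> Beta (site_a \<Delta> y + up_steps x n y) (site_b \<Delta> y + down_steps x n y) / Beta (site_a \<Delta> y) (site_b \<Delta> y)" for y
    using site_a_pos[OF D] site_b_pos[OF D]
    by (intro divide_nonneg_nonneg less_imp_le[OF Beta_pos]) (auto intro: add_pos_nonneg)
  have "(\<integral>\<^sup>+ \<omega>. ennreal (path_weight \<omega> x n) \<partial>env_law \<Delta>) =
      (\<integral>\<^sup>+ \<omega>. (\<Prod>y\<in>J. ennreal (\<omega> y ^ up_steps x n y * (1 - \<omega> y) ^ down_steps x n y)) \<partial>env_law \<Delta>)"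
    by (rule nn_integral_cong_AE, use AE_env_law[OF D] in eventually_elim)
       (auto simp: path_weight_eq_prod[OF J(1) x J(2)] less_imp_le intro!: prod_ennreal[symmetric])
  also have "\<dots> = (\<Prod>y\<in>J. \<integral>\<^sup>+ t. ennreal (t ^ up_steps x n y * (1 - t) ^ down_steps x n y) \<partial>site_law \<Delta> y)"
    by (rule nn_integral_env_law_prod[OF D J(1)]) simp
  also have "\<dots> = (\<Prod>y\<in>J. ennreal (Beta (site_a \<Delta> y + up_steps x n y) (site_b \<Delta> y + down_steps x n y) /
      Beta (site_a \<Delta> y) (site_b \<Delta> y)))"
    unfolding site_law_eq by (simp add: nn_integral_beta_measure_power site_a_pos site_b_pos D)
  also have "\<dots> = ennreal ?R"
    by (rule prod_ennreal) (rule pos)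
  finally have "(\<integral>\<^sup>+ \<omega>. ennreal (path_weight \<omega> x n) \<partial>env_law \<Delta>) = ennreal ?R" .
  moreover have "AE \<omega> in env_law \<Delta>. 0 \<le> path_weight \<omega> x n"
    using AE_elliptic[OF D] by eventually_elim (rule path_weight_bounds(1))
  ultimately show ?thesis
    unfolding path_prob_def by (subst integral_eq_nn_integral) (simp_all add: prod_nonneg pos)
qed

text \<open>One more step changes only the Beta factor of the site \<open>x n\<close>, and by the
  recursion of the Beta function it does so by \<open>a / (a + b)\<close> or
  \<open>b / (a + b)\<close>. Up to the common factor \<open>2 * \<Delta>\<close>, \<open>a\<close>
  and \<open>b\<close> are the current edge weights.\<close>

lemma path_prob_Suc:
  assumes D: "\<Delta> > 0" and x: "nn_path x (Suc n)"
  shows "path_prob \<Delta> x (Suc n) = path_prob \<Delta> x n *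
    (edge_weight \<Delta> x n {x n, x (Suc n)} / (edge_weight \<Delta> x n {x n, x n - 1} + edge_weight \<Delta> x n {x n, x n + 1}))"
proof -
  note x' = nn_path_SucD[OF x]
  define a where "a y = site_a \<Delta> y + real (up_steps x n y)" for y
  define b where "b y = site_b \<Delta> y + real (down_steps x n y)" for y
  define c where "c y = Beta (site_a \<Delta> y) (site_b \<Delta> y)" for y
  have pos: "a y > 0" "b y > 0" "c y > 0" for y
    using site_a_pos[OF D, of y] site_b_pos[OF D, of y]
    by (auto simp: a_def b_def c_def intro!: add_pos_nonneg Beta_pos)
  let ?J = "x ` {..n}"
  let ?y = "x n"
  have J: "finite ?J" "x ` {..<n} \<subseteq> ?J" "x ` {..<Suc n} \<subseteq> ?J" "?y \<in> ?J"
    by auto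
  \<comment> \<open>The step taken at time \<open>n\<close> is counted at the site
    \<open>x n\<close> alone.\<close>
  have other: "(\<Prod>y\<in>?J - {?y}. Beta (site_a \<Delta> y + up_steps x (Suc n) y) (site_b \<Delta> y + down_steps x (Suc n) y) / c y) =
    (\<Prod>y\<in>?J - {?y}. Beta (a y) (b y) / c y)"
    by (intro prod.cong) (auto simp: a_def b_def)
  have 0: "path_prob \<Delta> x n = Beta (a ?y) (b ?y) / c ?y * (\<Prod>y\<in>?J - {?y}. Beta (a y) (b y) / c y)"
    unfolding path_prob_eq_prod[OF D x' J(1,2)] a_def[symmetric] b_def[symmetric] c_def[symmetric]
    by (rule prod.remove[OF J(1,4)])
  have 1: "path_prob \<Delta> x (Suc n) =
      Beta (site_a \<Delta> ?y + up_steps x (Suc n) ?y) (site_b \<Delta> ?y + down_steps x (Suc n) ?y) / c ?y *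
      (\<Prod>y\<in>?J - {?y}. Beta (a y) (b y) / c y)"
    unfolding path_prob_eq_prod[OF D x J(1,3)] c_def[symmetric] other[symmetric]
    by (rule prod.remove[OF J(1,4)])
  have ew: "edge_weight \<Delta> x n {?y, ?y + 1} = 2 * \<Delta> * a ?y" "edge_weight \<Delta> x n {?y, ?y - 1} = 2 * \<Delta> * b ?y"
    using edge_weight_up[OF D x'] edge_weight_down[OF D x'] by (simp_all add: a_def b_def)
  have sum: "2 * \<Delta> * b ?y + 2 * \<Delta> * a ?y = 2 * \<Delta> * (a ?y + b ?y)" by (simp add: algebra_simps)
  have ratio: "2 * \<Delta> * t / (2 * \<Delta> * (a ?y + b ?y)) = t / (a ?y + b ?y)" for t
    using D by simp
  have ab: "a ?y + b ?y \<noteq> 0" using pos[of ?y] by linarith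
  have nonpole: "a ?y \<notin> \<int>\<^sub>\<le>\<^sub>0" "b ?y \<notin> \<int>\<^sub>\<le>\<^sub>0"
    using pos[of ?y] nonpos_Ints_nonpos[of "a ?y"] nonpos_Ints_nonpos[of "b ?y"] by linarith+
  from nn_path_Suc_step[OF x] show ?thesis
  proof
    assume up: "x (Suc n) = ?y + 1"
    have "Beta (a ?y + 1) (b ?y) = Beta (a ?y) (b ?y) * (a ?y / (a ?y + b ?y))"
      using Beta_plus1_left[OF nonpole(1), of "b ?y"] ab by (simp add: field_simps)
    moreover have "site_a \<Delta> ?y + up_steps x (Suc n) ?y = a ?y + 1" "site_b \<Delta> ?y + down_steps x (Suc n) ?y = b ?y"
      using up by (simp_all add: a_def b_def)
    ultimately show ?thesis
      unfolding 0 1 up ew sum ratio by (simp add: mult_ac del: up_steps.simps down_steps.simps)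
  next
    assume down: "x (Suc n) = ?y - 1"
    have "Beta (a ?y) (b ?y + 1) = Beta (a ?y) (b ?y) * (b ?y / (a ?y + b ?y))"
      using Beta_plus1_right[OF nonpole(2), of "a ?y"] ab by (simp add: field_simps)
    moreover have "site_a \<Delta> ?y + up_steps x (Suc n) ?y = a ?y" "site_b \<Delta> ?y + down_steps x (Suc n) ?y = b ?y + 1"
      using down by (simp_all add: a_def b_def)
    ultimately show ?thesis
      unfolding 0 1 down ew sum ratio by (simp add: mult_ac del: up_steps.simps down_steps.simps)
  qed
qed

text \<open>Both sides equal 1 for the path of length 0 and gain the same factor with every
  step.\<close>

lemma errw_path_prob:
  assumes D: "\<Delta> > 0" and errw: "is_errw \<Delta> M X"
  shows "nn_path x n \<Longrightarrow> \<P>(a in M. \<forall>i\<le>n. X i a = x i) = path_prob \<Delta> x n"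
proof (induction n)
  case 0
  interpret prob_space M using errw by (simp add: is_errw_def)
  interpret E: prob_space "env_law \<Delta>" by (rule prob_space_env_law[OF D])
  have "AE a in M. X 0 a = x 0" using errw 0 by (simp add: is_errw_def nn_path_def)
  moreover have [measurable]: "X 0 \<in> measurable M (count_space UNIV)" using errw by (simp add: is_errw_def)
  ultimately have "\<P>(a in M. X 0 a = x 0) = 1"
    by (subst prob_Collect_eq_1) auto
  then show ?case using E.prob_space by (simp add: path_prob_def path_weight_def)
next
  case (Suc n)
  interpret prob_space M using errw by (simp add: is_errw_def)
  have [measurable]: "\<And>n. X n \<in> measurable M (count_space UNIV)" using errw by (simp add: is_errw_def)
  note x = nn_path_SucD[OF Suc.prems]
  let ?H = "\<lambda>a. \<forall>i\<le>n. X i a = x i"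
  have eq: "\<P>(a in M. \<forall>i\<le>Suc n. X i a = x i) = \<P>(a in M. X (Suc n) a = x (Suc n) \<and> ?H a)"
    by (intro arg_cong[where f = prob]) (auto simp: le_Suc_eq)
  show ?case
  proof (cases "\<P>(a in M. ?H a) > 0")
    case True
    moreover have "x (Suc n) \<in> {x n - 1, x n + 1}" using nn_path_Suc_step[OF Suc.prems] by auto
    ultimately have "\<P>(a in M. X (Suc n) a = x (Suc n) \<bar> ?H a) =
        edge_weight \<Delta> x n {x n, x (Suc n)} / (edge_weight \<Delta> x n {x n, x n - 1} + edge_weight \<Delta> x n {x n, x n + 1})"
      using errw unfolding is_errw_def by blast
    then show ?thesis
      unfolding eq path_prob_Suc[OF D Suc.prems] Suc.IH[OF x, symmetric] cond_prob_def
      using True by (simp add: field_simps)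
  next
    case False
    \<comment> \<open>The transition rule is silent about null histories; there both sides vanish,
      the left one by monotonicity and the right one because its first factor is 0.\<close>
    then have 0: "\<P>(a in M. ?H a) = 0" by (simp add: zero_less_measure_iff)
    moreover have "\<P>(a in M. X (Suc n) a = x (Suc n) \<and> ?H a) \<le> \<P>(a in M. ?H a)"
      by (intro finite_measure_mono) auto
    ultimately have "\<P>(a in M. X (Suc n) a = x (Suc n) \<and> ?H a) = 0"
      by (simp add: measure_le_0_iff)
    then show ?thesis
      unfolding eq path_prob_Suc[OF D Suc.prems] Suc.IH[OF x, symmetric] 0 by simp
  qed
qed

lemma integrable_path_weight_walk_prob:
  assumes D: "\<Delta> > 0"
  shows "integrable (env_law \<Delta>) (\<lambda>\<omega>. path_weight \<omega> x n * walk_prob \<omega> k u v)"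
proof -
  interpret prob_space "env_law \<Delta>" by (rule prob_space_env_law[OF D])
  show ?thesis
  proof (rule integrable_const_bound[where B = 1])
    show "AE \<omega> in env_law \<Delta>. norm (path_weight \<omega> x n * walk_prob \<omega> k u v) \<le> 1"
      using AE_elliptic[OF D]
    proof eventually_elim
      case (elim \<omega>)
      then show ?case
        using path_weight_bounds[OF elim, of x n] walk_prob_nonneg[OF elim, of k u v] walk_prob_le_1[OF elim, of k u v]
        by (simp add: abs_mult mult_le_one)
    qed
  qed simp
qed

lemma integrable_path_weight:
  assumes D: "\<Delta> > 0"
  shows "integrable (env_law \<Delta>) (\<lambda>\<omega>. path_weight \<omega> x n)"
  using integrable_path_weight_walk_prob[OF D, of x n 0 0 0] by simp

text \<open>The two step probabilities of an environment add up to 1. The lemma serves to show that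
  the two neighbours exhaust the possible values of the reinforced walk at the next time.\<close>

lemma path_prob_split:
  assumes D: "\<Delta> > 0"
  shows "path_prob \<Delta> (x(Suc n := x n + 1)) (Suc n) + path_prob \<Delta> (x(Suc n := x n - 1)) (Suc n) = path_prob \<Delta> x n"
proof -
  have "path_prob \<Delta> (x(Suc n := x n + 1)) (Suc n) + path_prob \<Delta> (x(Suc n := x n - 1)) (Suc n) =
    (\<integral>\<omega>. path_weight \<omega> (x(Suc n := x n + 1)) (Suc n) + path_weight \<omega> (x(Suc n := x n - 1)) (Suc n) \<partial>env_law \<Delta>)"
    unfolding path_prob_def by (intro Bochner_Integration.integral_add[symmetric] integrable_path_weight D)
  also have "\<dots> = path_prob \<Delta> x n"
    unfolding path_weight_upd path_prob_def by (simp add: step_prob_def algebra_simps)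
  finally show ?thesis .
qed

lemma (in prob_space) prob_split_two_values:
  assumes Q: "{a \<in> space M. Q a} \<in> events" and Y: "Y \<in> measurable M (count_space UNIV)" and "u \<noteq> w"
  shows "prob {a \<in> space M. Q a} = prob {a \<in> space M. Q a \<and> Y a = u} + prob {a \<in> space M. Q a \<and> Y a = w} +
    prob {a \<in> space M. Q a \<and> (Y a \<noteq> u \<and> Y a \<noteq> w)}"
proof -
  have inter: "{a \<in> space M. Q a \<and> Y a \<in> B} = {a \<in> space M. Q a} \<inter> (Y -` B \<inter> space M)" for B
    by auto
  have ev: "{a \<in> space M. Q a \<and> Y a \<in> B} \<in> events" for B
    unfolding inter by (intro sets.Int Q measurable_sets[OF Y]) simp
  have disj: "prob {a \<in> space M. Q a \<and> Y a \<in> A \<union> B} =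
      prob {a \<in> space M. Q a \<and> Y a \<in> A} + prob {a \<in> space M. Q a \<and> Y a \<in> B}" if "A \<inter> B = {}" for A B
  proof -
    have "{a \<in> space M. Q a \<and> Y a \<in> A \<union> B} = {a \<in> space M. Q a \<and> Y a \<in> A} \<union> {a \<in> space M. Q a \<and> Y a \<in> B}"
      by auto
    with that show ?thesis
      by (subst finite_measure_Union[symmetric, OF ev ev]) auto
  qed
  show ?thesis
    using disj[of "{w}" "{u}"] disj[of "{u, w}" "- {u, w}"] assms(3) by simp
qed

text \<open>The reinforced walk is not a Markov chain, so the induction on \<open>k\<close> must
  carry the whole initial path. Each step extends this path by one of the two neighbours and matches
  the first-step recursion of \<open>walk_prob\<close>.\<close>

lemma errw_path_walk_prob:
  assumes D: "\<Delta> > 0" and errw: "is_errw \<Delta> M X"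
  shows "nn_path x n \<Longrightarrow> \<P>(a in M. (\<forall>i\<le>n. X i a = x i) \<and> X (n + k) a = v) =
    (\<integral>\<omega>. path_weight \<omega> x n * walk_prob \<omega> k (x n) v \<partial>env_law \<Delta>)"
proof (induction k arbitrary: x n)
  case 0
  have "{a \<in> space M. (\<forall>i\<le>n. X i a = x i) \<and> X (n + 0) a = v} =
      (if x n = v then {a \<in> space M. \<forall>i\<le>n. X i a = x i} else {})"
    by auto
  then have "\<P>(a in M. (\<forall>i\<le>n. X i a = x i) \<and> X (n + 0) a = v) =
      (if x n = v then \<P>(a in M. \<forall>i\<le>n. X i a = x i) else 0)"
    by simp
  then show ?case
    using errw_path_prob[OF D errw 0] by (simp add: path_prob_def)
next
  case (Suc k)
  interpret prob_space M using errw by (simp add: is_errw_def)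
  have [measurable]: "\<And>n. X n \<in> measurable M (count_space UNIV)" using errw by (simp add: is_errw_def)
  let ?H = "\<lambda>a. \<forall>i\<le>n. X i a = x i"
  let ?x = "\<lambda>w. x(Suc n := w)"
  let ?u = "x n + 1" and ?d = "x n - 1"
  have path: "nn_path (?x ?u) (Suc n)" "nn_path (?x ?d) (Suc n)"
    using Suc.prems by (auto intro: nn_path_upd)
  have H: "(\<forall>i\<le>Suc n. X i a = ?x w i) \<longleftrightarrow> ?H a \<and> X (Suc n) a = w" for a w
    by (auto simp: le_Suc_eq)
  let ?N = "\<lambda>a. X (Suc n) a \<noteq> ?u \<and> X (Suc n) a \<noteq> ?d"
  \<comment> \<open>The two one-step extensions already have the full probability of the path, so
    nothing is left for any other jump.\<close>
  have "\<P>(a in M. ?H a \<and> ?N a) = 0"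
    using prob_split_two_values[of ?H "X (Suc n)" ?u ?d] path_prob_split[OF D, of x n]
      errw_path_prob[OF D errw Suc.prems] errw_path_prob[OF D errw path(1)] errw_path_prob[OF D errw path(2)]
    unfolding H by simp
  moreover have "\<P>(a in M. (?H a \<and> X (n + Suc k) a = v) \<and> ?N a) \<le> \<P>(a in M. ?H a \<and> ?N a)"
    by (intro finite_measure_mono) auto
  ultimately have null: "\<P>(a in M. (?H a \<and> X (n + Suc k) a = v) \<and> ?N a) = 0"
    by (simp only: measure_le_0_iff)
  have "\<P>(a in M. ?H a \<and> X (n + Suc k) a = v) =
      \<P>(a in M. (?H a \<and> X (n + Suc k) a = v) \<and> X (Suc n) a = ?u) +
      \<P>(a in M. (?H a \<and> X (n + Suc k) a = v) \<and> X (Suc n) a = ?d)"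
    using null prob_split_two_values[of "\<lambda>a. ?H a \<and> X (n + Suc k) a = v" "X (Suc n)" ?u ?d] by simp
  also have "\<dots> = \<P>(a in M. (?H a \<and> X (Suc n) a = ?u) \<and> X (Suc n + k) a = v) +
      \<P>(a in M. (?H a \<and> X (Suc n) a = ?d) \<and> X (Suc n + k) a = v)"
    by (intro arg_cong2[where f = "(+)"] arg_cong[where f = prob]) auto
  also have "\<dots> = (\<integral>\<omega>. path_weight \<omega> (?x ?u) (Suc n) * walk_prob \<omega> k ?u v \<partial>env_law \<Delta>) +
      (\<integral>\<omega>. path_weight \<omega> (?x ?d) (Suc n) * walk_prob \<omega> k ?d v \<partial>env_law \<Delta>)"
    using Suc.IH[OF path(1)] Suc.IH[OF path(2)] unfolding H by (simp add: fun_upd_def)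
  also have "\<dots> = (\<integral>\<omega>. path_weight \<omega> (?x ?u) (Suc n) * walk_prob \<omega> k ?u v +
      path_weight \<omega> (?x ?d) (Suc n) * walk_prob \<omega> k ?d v \<partial>env_law \<Delta>)"
    by (intro Bochner_Integration.integral_add[symmetric] integrable_path_weight_walk_prob D)
  also have "\<dots> = (\<integral>\<omega>. path_weight \<omega> x n * walk_prob \<omega> (Suc k) (x n) v \<partial>env_law \<Delta>)"
    unfolding path_weight_upd by (simp add: step_prob_def algebra_simps)
  finally show ?case .
qed

lemma errw_prob:
  assumes D: "\<Delta> > 0" and errw: "is_errw \<Delta> M X"
  shows "\<P>(a in M. X k a = v) = (\<integral>\<omega>. walk_prob \<omega> k 0 v \<partial>env_law \<Delta>)"
proof -
  interpret prob_space M using errw by (simp add: is_errw_def)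
  have [measurable]: "\<And>n. X n \<in> measurable M (count_space UNIV)" using errw by (simp add: is_errw_def)
  have X0: "AE a in M. X 0 a = 0" using errw by (simp add: is_errw_def)
  \<comment> \<open>The path of length 0 is a condition at time 0 only, and it holds almost
    surely.\<close>
  have "\<P>(a in M. X k a = v) = \<P>(a in M. (\<forall>i\<le>0. X i a = 0) \<and> X (0 + k) a = v)"
    by (rule prob_eq_AE) (use X0 in auto)
  also have "\<dots> = (\<integral>\<omega>. path_weight \<omega> (\<lambda>_. 0) 0 * walk_prob \<omega> k 0 v \<partial>env_law \<Delta>)"
    by (rule errw_path_walk_prob[OF D errw, of "\<lambda>_. 0" 0]) (simp add: nn_path_def)
  finally show ?thesis by (simp add: path_weight_def)
qed

lemma errw_averages_tendsto:
  assumes D: "\<Delta> > 0" and errw: "is_errw \<Delta> M X"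
  shows "(\<lambda>m. (1 / (real m + 1)) * (\<Sum>n=0..m. \<P>(a in M. X n a = x))) \<longlonglongrightarrow> limit_mass \<Delta> x"
proof -
  interpret E: prob_space "env_law \<Delta>" by (rule prob_space_env_law[OF D])
  have int: "integrable (env_law \<Delta>) (\<lambda>\<omega>. walk_prob \<omega> n 0 x)" for n
    using integrable_path_weight_walk_prob[OF D, of "\<lambda>_. 0" 0 n 0 x] by (simp add: path_weight_def)
  have eq: "(1 / (real m + 1)) * (\<Sum>n=0..m. \<P>(a in M. X n a = x)) =
      (\<integral>\<omega>. (1 / (real m + 1)) * (\<Sum>n=0..m. walk_prob \<omega> n 0 x) \<partial>env_law \<Delta>)" for m
    by (simp add: errw_prob[OF D errw] int)
  show ?thesis
    unfolding eq limit_mass_def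
  proof (rule integral_dominated_convergence[where w = "\<lambda>_. 1"])
    show "AE \<omega> in env_law \<Delta>. (\<lambda>m. (1 / (real m + 1)) * (\<Sum>n=0..m. walk_prob \<omega> n 0 x))
        \<longlonglongrightarrow> stat_env \<omega> x * inverse (stat_norm \<omega>)"
      using AE_summable_stat_env[OF D] by eventually_elim (blast intro: ergodic_average_walk_prob)
    show "AE \<omega> in env_law \<Delta>. norm ((1 / (real m + 1)) * (\<Sum>n=0..m. walk_prob \<omega> n 0 x)) \<le> 1" for m
      using AE_elliptic[OF D]
    proof eventually_elim
      case (elim \<omega>)
      have "(\<Sum>n=0..m. walk_prob \<omega> n 0 x) \<le> (\<Sum>n=0..m. 1)"
        by (intro sum_mono walk_prob_le_1 elim)
      moreover have "0 \<le> (\<Sum>n=0..m. walk_prob \<omega> n 0 x)"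
        by (intro sum_nonneg walk_prob_nonneg elim)
      ultimately show ?case by (simp add: abs_mult add.commute)
    qed
  qed simp_all
qed

theorem theorem5p1:
  shows "(\<forall>\<Delta>>0::real.
       (\<forall>x. 0 \<le> limit_mass \<Delta> x) \<and> prob_space (limit_law \<Delta>) \<and>
       (\<forall>(M :: 'a measure) X x. is_errw \<Delta> M X \<longrightarrow>
          (\<lambda>m. (1 / (real m + 1)) * (\<Sum>n=0..m. \<P>(a in M. X n a = x)))
            \<longlonglongrightarrow> limit_mass \<Delta> x) \<and>
       (\<forall>x. limit_mass \<Delta> (- x) = limit_mass \<Delta> x) \<and>
       (\<forall>(N :: 'b measure) Y.
          prob_space N \<and> Y \<in> measurable N (count_space UNIV) \<and>
          distr N (count_space UNIV) Y = limit_law \<Delta> \<longrightarrow>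
            (\<integral>b. real_of_int (Y b) \<partial>N) = 0 \<and>
            (\<forall>n. integrable N (\<lambda>b. real_of_int (Y b) ^ n)) \<and>
            (\<forall>n. odd n \<longrightarrow> (\<integral>b. real_of_int (Y b) ^ n \<partial>N) = 0) \<and>
            (\<forall>n. even n \<longrightarrow> (\<integral>b. real_of_int (Y b) ^ n \<partial>N) > 0))) \<and>
     (\<exists>C d :: real \<Rightarrow> real.
       (\<forall>\<Delta>>0. C \<Delta> > 0 \<and> d \<Delta> > 0 \<and>
          (\<forall>x. limit_mass \<Delta> x \<le> C \<Delta> * exp (- d \<Delta> * real_of_int \<bar>x\<bar>))) \<and>
       (d \<longlongrightarrow> 0) (at_right 0) \<and> filterlim d at_top at_top)"
proof (rule conjI)
  show "\<forall>\<Delta>>0::real.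
       (\<forall>x. 0 \<le> limit_mass \<Delta> x) \<and> prob_space (limit_law \<Delta>) \<and>
       (\<forall>(M :: 'a measure) X x. is_errw \<Delta> M X \<longrightarrow>
          (\<lambda>m. (1 / (real m + 1)) * (\<Sum>n=0..m. \<P>(a in M. X n a = x)))
            \<longlonglongrightarrow> limit_mass \<Delta> x) \<and>
       (\<forall>x. limit_mass \<Delta> (- x) = limit_mass \<Delta> x) \<and>
       (\<forall>(N :: 'b measure) Y.
          prob_space N \<and> Y \<in> measurable N (count_space UNIV) \<and>
          distr N (count_space UNIV) Y = limit_law \<Delta> \<longrightarrow>
            (\<integral>b. real_of_int (Y b) \<partial>N) = 0 \<and>
            (\<forall>n. integrable N (\<lambda>b. real_of_int (Y b) ^ n)) \<and>
            (\<forall>n. odd n \<longrightarrow> (\<integral>b. real_of_int (Y b) ^ n \<partial>N) = 0) \<and>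
            (\<forall>n. even n \<longrightarrow> (\<integral>b. real_of_int (Y b) ^ n \<partial>N) > 0))"
  proof (intro allI impI conjI)
    fix \<Delta> :: real assume D: "\<Delta> > 0"
    show "0 \<le> limit_mass \<Delta> x" for x
      using limit_mass_pos[OF D] by (rule less_imp_le)
    show "prob_space (limit_law \<Delta>)"
      by (rule prob_space_limit_law[OF D])
    show "(\<lambda>m. (1 / (real m + 1)) * (\<Sum>n=0..m. \<P>(a in M. X n a = x))) \<longlonglongrightarrow> limit_mass \<Delta> x"
      if "is_errw \<Delta> M X" for M :: "'a measure" and X x
      by (rule errw_averages_tendsto[OF D that])
    show "limit_mass \<Delta> (- x) = limit_mass \<Delta> x" for x
      by (rule limit_mass_uminus[OF D])
    fix N :: "'b measure" and Y
    assume "prob_space N \<and> Y \<in> measurable N (count_space UNIV) \<and> distr N (count_space UNIV) Y = limit_law \<Delta>"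
    then have Y: "Y \<in> measurable N (count_space UNIV)" "distr N (count_space UNIV) Y = limit_law \<Delta>"
      by auto
    note moments = moments_of_limit_law[OF D Y]
    show "(\<integral>b. real_of_int (Y b) \<partial>N) = 0"
      using moments(2)[of 1] limit_moment_odd[OF D, of 1] by simp
    show "integrable N (\<lambda>b. real_of_int (Y b) ^ n)" for n
      by (rule moments(1))
    show "(\<integral>b. real_of_int (Y b) ^ n \<partial>N) = 0" if "odd n" for n
      using limit_moment_odd[OF D that] by (simp add: moments(2))
    show "(\<integral>b. real_of_int (Y b) ^ n \<partial>N) > 0" if "even n" for n
      using limit_moment_even[OF D that] by (simp add: moments(2))
  qed
  show "\<exists>C d :: real \<Rightarrow> real.
       (\<forall>\<Delta>>0. C \<Delta> > 0 \<and> d \<Delta> > 0 \<and>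
          (\<forall>x. limit_mass \<Delta> x \<le> C \<Delta> * exp (- d \<Delta> * real_of_int \<bar>x\<bar>))) \<and>
       (d \<longlongrightarrow> 0) (at_right 0) \<and> filterlim d at_top at_top"
    by (intro exI[of _ decay_const] exI[of _ decay_rate] conjI allI impI decay_const_pos decay_rate_pos
        limit_mass_le_exp decay_rate_tendsto_0 decay_rate_at_top)
qed

end
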